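(* Let $n$ be a non-zero integer. Let $D_{3,n}(N)$ be the number of $D(n)$-triples with all elements in $\{1,2,\dots,N\}$ and $D_{2,n}(N)$ the number of $D(n)$-pairs with both elements in $\{1,2,\dots,N\}$. Then $D_{3,n}(N)\sim \frac{D_{2,n}(N)}{2}$ as $N\to\infty$.
   Context: For a non-zero integer $n$ and $m\ge2$, a $D(n)$-$m$-tuple is a set $\{a_1,\dots,a_m\}$ of $m$ distinct positive integers such that $a_ia_j+n$ is a perfect square for all $1\le i<j\le m$; $D(n)$-pairs and $D(n)$-triples are the cases $m=2$ and $m=3$. *)

theory Defs
  imports Complex_Main
    "HOL-Library.Landau_Symbols"
    "HOL-Computational_Algebra.Nth_Powers"
begin

(* The product is taken over the integers, so that negative n is treated without truncation;
   0 counts as a perfect square. *)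
definition D_tuple :: "int \<Rightarrow> nat \<Rightarrow> nat set \<Rightarrow> bool" where
  "D_tuple n m A \<longleftrightarrow> finite A \<and> card A = m \<and> (\<forall>a\<in>A. 0 < a) \<and>
     (\<forall>a\<in>A. \<forall>b\<in>A. a \<noteq> b \<longrightarrow> is_square (int a * int b + n))"

definition D_count :: "nat \<Rightarrow> int \<Rightarrow> nat \<Rightarrow> nat" where
  "D_count m n N = card {A. A \<subseteq> {1..N} \<and> D_tuple n m A}"

end

theory Submission
  imports Defs "HOL-Number_Theory.Number_Theory" "HOL-Analysis.Harmonic_Numbers" "HOL-Real_Asymp.Real_Asymp"
begin

text \<open>A pair \<open>a < c\<close> with \<open>a c + n = r\<^sup>2\<close> is a square root \<open>r\<close> of \<open>n\<close> modulo \<open>c\<close> with \<open>0 < r < c\<close>, up to boundary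
  effects. The reflection \<open>r \<mapsto> c - r\<close> pairs up these roots, and the two cofactors \<open>a\<close>, \<open>b\<close> belonging to
  \<open>r\<close> and \<open>c - r\<close> satisfy \<open>a b + n = (r - a)\<^sup>2\<close>, so each reflected pair of roots yields one triple
  \<open>{a, b, c}\<close>. Every other triple \<open>a < b < c\<close> has \<open>a b = O(c)\<close>, and the divisor bound shows that
  there are only \<open>O(N powr (7/8))\<close> of these.

  It remains to see that the boundary effects are negligible. For non-square \<open>n\<close> they are bounded,
  and values of the form \<open>x\<^sup>2 - n y\<^sup>2\<close> provide at least \<open>N powr (31/32)\<close> pairs. For \<open>n = k\<^sup>2\<close> they are \<open>O(N)\<close>, and
  roots that are \<open>k\<close> modulo one factor of \<open>c\<close> and \<open>- k\<close> modulo the other show that the number of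
  pairs grows faster than \<open>N\<close>.\<close>

section \<open>Divisors and totients\<close>

text \<open>The order of growth of the number of pairs is never computed: pairs and triples are both
  compared with the same set of roots, which only has to outnumber every error term. Square
  \<open>n\<close> is the obstacle. If \<open>n = k^2\<close>, then \<open>k\<close> is a root
  modulo every \<open>c\<close> with cofactor 0, and for \<open>c > 2 k\<close> its reflection
  \<open>c - k\<close> belongs to the genuine pair \<open>{c - 2 k, c}\<close>, which therefore has
  no partner. About \<open>N\<close> pairs are lost in this way, so a lower bound of order
  \<open>N powr (31/32)\<close> is not enough, and the divergence of the harmonic series has to
  supply the missing growth.

  Both exponents come from using the divisor bound with \<open>\<delta> = 1/16\<close>: the
  irregular triples cost it twice on top of \<open>3/4\<close>, and the lower bound loses half of it
  from \<open>1\<close>. The comparison \<open>3/4 + 2 \<delta> < 1 - \<delta>/2\<close> only asks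
  for \<open>\<delta> < 1/10\<close>.\<close>

lemma card_divisors_prime_power_mult:
  fixes p m :: nat
  assumes "prime p" "m > 0"
  shows "card {d. d dvd p ^ a * m} \<le> (a + 1) * card {d. d dvd m}"
proof -
  have "{d. d dvd p ^ a * m} \<subseteq> (\<lambda>(i, e). p ^ i * e) ` ({..a} \<times> {d. d dvd m})"
  proof
    fix d assume "d \<in> {d. d dvd p ^ a * m}"
    then obtain u v where "d = u * v" "u dvd p ^ a" "v dvd m"
      using dvd_productE[of d "p ^ a" m] by auto
    moreover obtain i where "i \<le> a" "u = p ^ i"
      using \<open>u dvd p ^ a\<close> assms(1) divides_primepow_nat by blast
    ultimately show "d \<in> (\<lambda>(i, e). p ^ i * e) ` ({..a} \<times> {d. d dvd m})"
      by force
  qed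
  moreover have fin: "finite ({..a} \<times> {d. d dvd m})"
    using assms(2) by auto
  ultimately have "card {d. d dvd p ^ a * m} \<le> card ({..a} \<times> {d. d dvd m})"
    by (meson card_image_le card_mono finite_imageI le_trans)
  then show ?thesis by (simp add: card_cartesian_product)
qed

text \<open>Only the finitely many primes with \<open>p powr \<delta> < 2\<close> contribute a factor exceeding one
  to the quotient of the divisor function and \<open>m powr \<delta>\<close>.\<close>

lemma divisor_bound:
  fixes \<delta> :: real
  assumes "\<delta> > 0"
  obtains C where "C \<ge> 1" "\<And>m. m > 0 \<Longrightarrow> real (card {d. d dvd m}) \<le> C * real m powr \<delta>"
proof -
  \<comment> \<open>This makes \<open>K * \<delta> * ln 2 \<ge> 1\<close>, hence
    \<open>a \<le> K * a * \<delta> * ln 2\<close>; then \<open>1 + x \<le> exp x\<close> bounds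
    \<open>a + 1\<close> for every prime at once.\<close>
  define K where "K = max 1 (1 / (\<delta> * ln 2))"
  have K1: "K \<ge> 1" by (simp add: K_def)
  define P where "P = nat \<lceil>2 powr (1 / \<delta>)\<rceil>"
  have small: "real (a + 1) \<le> K * real p powr (real a * \<delta>)" if "p \<ge> 2" for p a :: nat
  proof -
    have "K * (\<delta> * ln 2) \<ge> 1"
      using assms by (auto simp: K_def field_simps max_def)
    then have "real a * 1 \<le> real a * (K * (\<delta> * ln 2))"
      by (intro mult_left_mono) auto
    then have "real (a + 1) \<le> K * (1 + real a * \<delta> * ln 2)"
      using K1 by (simp add: algebra_simps)
    also have "\<dots> \<le> K * exp (real a * \<delta> * ln 2)"
      using K1 by (intro mult_left_mono) auto
    also have "\<dots> = K * 2 powr (real a * \<delta>)" by (simp add: powr_def)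
    also have "\<dots> \<le> K * real p powr (real a * \<delta>)"
      using K1 that assms by (intro mult_left_mono powr_mono2) auto
    finally show ?thesis .
  qed
  have large: "real (a + 1) \<le> real p powr (real a * \<delta>)" if "p \<ge> P" for p a :: nat
  proof -
    have "2 powr (1 / \<delta>) \<le> real p" using that by (simp add: P_def)
    then have "(2 powr (1 / \<delta>)) powr (real a * \<delta>) \<le> real p powr (real a * \<delta>)"
      using assms by (intro powr_mono2) auto
    then have "2 powr real a \<le> real p powr (real a * \<delta>)"
      using assms by (simp add: powr_powr)
    moreover have "real (a + 1) \<le> 2 ^ a"
      by (induction a) auto
    ultimately show ?thesis by (simp add: powr_realpow)
  qed
  \<comment> \<open>The small primes dividing \<open>m\<close> each cost a factor \<open>K\<close>.
    Removing a full prime power from \<open>m\<close> lowers this count by one if the prime is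
    small; in the end the count is at most \<open>P\<close>.\<close>
  define Q where "Q = (\<lambda>m::nat. {p. p < P \<and> p dvd m})"
  have finQ: "finite (Q m)" for m by (simp add: Q_def)
  have main: "real (card {d. d dvd m}) \<le> K ^ card (Q m) * real m powr \<delta>" if "m > 0" for m
    using that
  proof (induction m rule: less_induct)
    case (less m)
    show ?case
    proof (cases "m = 1")
      case True
      then show ?thesis using K1 by simp
    next
      case False
      then obtain p where p: "prime p" "p dvd m" using prime_factor_nat by blast
      define a where "a = multiplicity p m"
      obtain m' where m': "m = p ^ a * m'" "\<not> p dvd m'"
        using multiplicity_decompose'[of m p] less.prems p(1) unfolding a_def
        by (metis not_prime_unit prime_gt_0_nat neq0_conv)
      have m'0: "m' > 0" using m' less.prems by (cases m') auto
      have p2: "p \<ge> 2" using p(1) prime_ge_2_nat by blast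
      have a0: "a \<noteq> 0" using m' p(2) by (metis mult_1 power_0)
      have "m' < m" using m' m'0 a0 p2
        by (metis One_nat_def less_le_trans mult_less_cancel2 nat_mult_1 numeral_2_eq_2 one_less_power lessI zero_less_iff_neq_zero)
      note IH = less.IH[OF this m'0]
      define q where "q = (if p < P then K else 1)"
      have aq: "real (a + 1) \<le> q * real p powr (real a * \<delta>)"
        using small[OF p2, of a] large[of p a] by (auto simp: q_def)
      have q: "q * K ^ card (Q m') \<le> K ^ card (Q m)"
      proof (cases "p < P")
        case True
        then have "Q m' \<subset> Q m" using p m' by (auto simp: Q_def)
        then have "card (Q m') < card (Q m)" using finQ psubset_card_mono by blast
        then have "K ^ Suc (card (Q m')) \<le> K ^ card (Q m)"
          using K1 by (intro power_increasing) auto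
        then show ?thesis using True by (simp add: q_def)
      next
        case False
        have "Q m' \<subseteq> Q m" using m' by (auto simp: Q_def)
        then have "card (Q m') \<le> card (Q m)" using finQ card_mono by blast
        then show ?thesis using K1 False by (simp add: q_def power_increasing)
      qed
      have "real (card {d. d dvd m}) \<le> real ((a + 1) * card {d. d dvd m'})"
        using card_divisors_prime_power_mult[OF p(1) m'0, of a] m' by (simp only: of_nat_le_iff)
      also have "\<dots> = real (a + 1) * real (card {d. d dvd m'})" by (rule of_nat_mult)
      also have "\<dots> \<le> (q * real p powr (real a * \<delta>)) * (K ^ card (Q m') * real m' powr \<delta>)"
        using aq IH by (intro mult_mono) auto
      also have "\<dots> = (q * K ^ card (Q m')) * (real p powr (real a * \<delta>) * real m' powr \<delta>)"
        by (simp add: algebra_simps)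
      also have "real p powr (real a * \<delta>) * real m' powr \<delta> = real m powr \<delta>"
        using m' p2 by (simp add: powr_mult powr_powr flip: powr_realpow)
      also have "(q * K ^ card (Q m')) * real m powr \<delta> \<le> K ^ card (Q m) * real m powr \<delta>"
        using q by (intro mult_right_mono) auto
      finally show ?thesis .
    qed
  qed
  show ?thesis
  proof (rule that[of "K ^ P"])
    show "K ^ P \<ge> 1" using K1 by simp
    fix m :: nat assume m: "m > 0"
    have "card (Q m) \<le> card {..<P}" by (intro card_mono) (auto simp: Q_def)
    then have "K ^ card (Q m) \<le> K ^ P" using K1 by (intro power_increasing) auto
    then have "K ^ card (Q m) * real m powr \<delta> \<le> K ^ P * real m powr \<delta>"
      by (intro mult_right_mono) auto
    with main[OF m] show "real (card {d. d dvd m}) \<le> K ^ P * real m powr \<delta>" by linarith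
  qed
qed

text \<open>Gauss's identity writes \<open>y\<close> as the sum of the totients of its divisors,
  none of which exceeds \<open>totient y\<close>. Together with the divisor bound this shows that
  the totient is nearly as large as \<open>y\<close>.\<close>

lemma totient_ge_div_card_divisors:
  assumes "y > 0"
  shows "y \<le> totient y * card {d. d dvd y}"
proof -
  have "y = (\<Sum>d | d dvd y. totient d)" by (simp add: totient_divisor_sum)
  also have "\<dots> \<le> (\<Sum>d | d dvd y. totient y)"
    using assms by (intro sum_mono) (auto intro!: dvd_imp_le totient_dvd_mono simp: totient_gt_0_iff)
  finally show ?thesis by (simp add: mult.commute)
qed

text \<open>The interval splits into \<open>q\<close> full periods modulo \<open>y\<close>, and each
  contains a translate of the totatives.\<close>

lemma card_coprime_interval_ge:
  assumes "y > 0"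
  shows "q * totient y \<le> card {x. y * m < x \<and> x \<le> y * (m + q) \<and> coprime x y}"
proof -
  define f where "f = (\<lambda>(i, u). y * (m + i) + u)"
  have inj: "inj_on f ({..<q} \<times> totatives y)"
  proof (rule inj_onI)
    fix p p' assume "p \<in> {..<q} \<times> totatives y" "p' \<in> {..<q} \<times> totatives y" "f p = f p'"
    then obtain i u j v where p: "p = (i, u)" "p' = (j, v)"
      and *: "u \<in> totatives y" "v \<in> totatives y" "f (i, u) = f (j, v)" by auto
    have b: "0 < u" "u \<le> y" "0 < v" "v \<le> y" using * by (auto simp: in_totatives_iff)
    have "i = j"
    proof (rule ccontr)
      assume "i \<noteq> j"
      then consider "i + 1 \<le> j" | "j + 1 \<le> i" by linarith
      then show False
      proof cases
        case 1
        then have "y * (m + i + 1) \<le> y * (m + j)" by (intro mult_le_mono2) simp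
        then show False using * b by (simp add: f_def algebra_simps)
      next
        case 2
        then have "y * (m + j + 1) \<le> y * (m + i)" by (intro mult_le_mono2) simp
        then show False using * b by (simp add: f_def algebra_simps)
      qed
    qed
    with * p show "p = p'" by (simp add: f_def)
  qed
  have "f ` ({..<q} \<times> totatives y) \<subseteq> {x. y * m < x \<and> x \<le> y * (m + q) \<and> coprime x y}"
  proof (rule image_subsetI)
    fix p assume "p \<in> {..<q} \<times> totatives y"
    then obtain i u where p: "p = (i, u)" and *: "i \<in> {..<q}" "u \<in> totatives y" by blast
    then have u: "0 < u" "u \<le> y" "coprime u y" by (auto simp: in_totatives_iff)
    have "y * (m + i + 1) \<le> y * (m + q)" using * by (intro mult_le_mono2) simp
    moreover have "coprime (y * (m + i) + u) y"
      using u(3) by (metis coprime_commute coprime_iff_gcd_eq_1 gcd_add_mult add.commute mult.commute)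
    ultimately show "f p \<in> {x. y * m < x \<and> x \<le> y * (m + q) \<and> coprime x y}"
      using u unfolding p f_def prod.case add_mult_distrib2 mem_Collect_eq by linarith
  qed
  moreover have "finite {x. y * m < x \<and> x \<le> y * (m + q) \<and> coprime x y}"
    by (rule finite_subset[of _ "{..y * (m + q)}"]) auto
  ultimately have "card ({..<q} \<times> totatives y) \<le> card {x. y * m < x \<and> x \<le> y * (m + q) \<and> coprime x y}"
    using inj card_inj_on_le by blast
  then show ?thesis by (simp add: card_cartesian_product totient_def)
qed

lemma real_div_le_nat_div:
  assumes "d > 0"
  shows "real n / real d - 1 \<le> real (n div d)"
proof -
  have "n < (n div d + 1) * d" using dividend_less_div_times[OF assms, of n] by (simp add: algebra_simps)
  then have "real n < real ((n div d + 1) * d)" by (simp only: of_nat_less_iff)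
  then have "real n < (real (n div d) + 1) * real d" by (simp add: algebra_simps)
  then have "real n / real d < real (n div d) + 1" using assms by (simp add: pos_divide_less_eq)
  then show ?thesis by linarith
qed

lemma sum_inverse_squares_le: "(\<Sum>e=1..Y. 1 / real e ^ 2) \<le> 2"
proof -
  have "(\<Sum>e=1..Y. 1 / real e ^ 2) \<le> 2 - 1 / real Y" if "Y \<ge> 1"
    using that
  proof (induction Y rule: dec_induct)
    case base
    then show ?case by simp
  next
    case (step k)
    have "1 / real (Suc k) ^ 2 \<le> 1 / real k - 1 / real (Suc k)"
    proof -
      have "1 / real (Suc k) ^ 2 \<le> 1 / (real k * real (Suc k))"
        using step by (intro divide_left_mono) (auto simp: power2_eq_square)
      also have "\<dots> = 1 / real k - 1 / real (Suc k)"
        using step by (simp add: field_simps)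
      finally show ?thesis .
    qed
    with step.IH show ?case by simp
  qed
  then show ?thesis by (cases "Y = 0") (auto intro: order_trans)
qed

text \<open>Expanding \<open>1 / y\<close> as the sum of \<open>totient d / y^2\<close> over
  \<open>d dvd y\<close> and writing \<open>y = d * e\<close> bounds the harmonic sum by this sum
  times the convergent sum of \<open>1 / e^2\<close>. The divergence is what gives more than
  linearly many pairs for square \<open>n\<close>.\<close>

lemma sum_totient_div_square_at_top:
  "filterlim (\<lambda>Y. \<Sum>y=1..Y. real (totient y) / real y ^ 2) at_top sequentially"
proof -
  have "harm Y \<le> 2 * (\<Sum>y=1..Y. real (totient y) / real y ^ 2)" for Y :: nat
  proof -
    have "(harm Y :: real) = (\<Sum>y=1..Y. \<Sum>d | d dvd y. real (totient d) / real y ^ 2)"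
    proof (unfold harm_def, rule sum.cong)
      fix y assume "y \<in> {1..Y}"
      have "(\<Sum>d | d dvd y. real (totient d) / real y ^ 2) = real (\<Sum>d | d dvd y. totient d) / real y ^ 2"
        by (simp add: sum_divide_distrib)
      also have "\<dots> = inverse (real y)"
        by (simp only: totient_divisor_sum) (simp add: power2_eq_square field_simps)
      finally show "inverse (real y) = (\<Sum>d | d dvd y. real (totient d) / real y ^ 2)" by simp
    qed simp
    also have "\<dots> = (\<Sum>(y, d)\<in>(SIGMA y:{1..Y}. {d. d dvd y}). real (totient d) / real y ^ 2)"
      by (subst sum.Sigma) auto
    \<comment> \<open>Dropping the restriction \<open>d * e \<le> Y\<close> lets the double sum
      factor.\<close>
    also have "\<dots> \<le> (\<Sum>(d, e)\<in>{1..Y} \<times> {1..Y}. real (totient d) / real (d * e) ^ 2)"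
    proof (rule sum_le_included[where i = "\<lambda>(d, e). (d * e, d)"])
      show "\<forall>yd\<in>(SIGMA y:{1..Y}. {d. d dvd y}). \<exists>de\<in>{1..Y} \<times> {1..Y}.
          (\<lambda>(d, e). (d * e, d)) de = yd \<and>
          (\<lambda>(y, d). real (totient d) / real y ^ 2) yd \<le> (\<lambda>(d, e). real (totient d) / real (d * e) ^ 2) de"
      proof clarify
        fix y d assume *: "y \<in> {1..Y}" "d dvd y"
        then obtain e where "y = d * e" by blast
        with * show "\<exists>de\<in>{1..Y} \<times> {1..Y}. (\<lambda>(d, e). (d * e, d)) de = (y, d) \<and>
            real (totient d) / real y ^ 2 \<le> (\<lambda>(d, e). real (totient d) / real (d * e) ^ 2) de"
          using dvd_imp_le[of d y] dvd_imp_le[of e y]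
          by (intro bexI[of _ "(d, e)"]) (auto intro: le_trans[of _ "d * e"])
      qed
    qed auto
    also have "\<dots> = (\<Sum>d=1..Y. \<Sum>e=1..Y. (real (totient d) / real d ^ 2) * (1 / real e ^ 2))"
      by (subst sum.cartesian_product) (simp add: power_mult_distrib)
    also have "\<dots> = (\<Sum>d=1..Y. real (totient d) / real d ^ 2) * (\<Sum>e=1..Y. 1 / real e ^ 2)"
      by (simp add: sum_product)
    also have "\<dots> \<le> (\<Sum>d=1..Y. real (totient d) / real d ^ 2) * 2"
      by (intro mult_left_mono sum_inverse_squares_le sum_nonneg) auto
    finally show ?thesis by simp
  qed
  then have le: "harm Y / 2 \<le> (\<Sum>y=1..Y. real (totient y) / real y ^ 2)" for Y :: nat
    by (simp add: field_simps)
  have "filterlim (\<lambda>Y. harm Y / 2 :: real) at_top sequentially"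
    using filterlim_tendsto_pos_mult_at_top[OF tendsto_const[of "1/2"] _ harm_at_top] by simp
  then show ?thesis
    by (rule filterlim_at_top_mono) (use le in \<open>auto intro: always_eventually\<close>)
qed

lemma sum_inverse_sqrt_le: "(\<Sum>i=1..m. 1 / sqrt (real i)) \<le> 2 * sqrt (real m)"
proof (induction m)
  case (Suc m)
  define s t where "s = sqrt (real m)" and "t = sqrt (real (Suc m))"
  have "t > 0" "t\<^sup>2 = s\<^sup>2 + 1" by (auto simp: s_def t_def)
  \<comment> \<open>Since \<open>t^2 - s^2 = 1\<close>, this is the same as
    \<open>1 \<le> 2 * t * (t - s)\<close>.\<close>
  moreover have "(t - s)\<^sup>2 \<ge> 0" by simp
  ultimately have "1 / t \<le> 2 * t - 2 * s"
    by (simp add: field_simps power2_eq_square)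
  with Suc show ?case by (simp add: s_def t_def)
qed simp

section \<open>Square roots modulo an integer\<close>

text \<open>The last hypothesis says \<open>s t = c r - n\<close> or \<open>s t = c r + n\<close>.
  Squaring and cancelling \<open>n c\<close> leaves \<open>c = a + b + 2 r\<close> or
  \<open>c = a + b - 2 r\<close>. The first is the classical regular extension, with
  \<open>s = a + r\<close> and \<open>t = b + r\<close>. The second forces \<open>2 r < a\<close>,
  so \<open>a b + n\<close> is less than a quarter of \<open>a b\<close>, which is possible only for
  \<open>c\<close> below \<open>4 * \<bar>n\<bar>\<close>.\<close>

lemma regular_of_square_eq:
  fixes a b c r s t n :: int
  assumes "n \<noteq> 0" "0 < a" "a < b" "b < c"
    and sq: "a * b + n = r\<^sup>2" "a * c + n = s\<^sup>2" "b * c + n = t\<^sup>2"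
    and nonneg: "0 \<le> r" "0 \<le> s" "0 \<le> t"
    and c: "4 * \<bar>n\<bar> \<le> c"
    and w: "(c * r - s * t)\<^sup>2 = n\<^sup>2"
  shows "s + t = c"
proof -
  have "c * r - s * t = n \<or> c * r - s * t = - n"
    using w by (simp add: power2_eq_iff)
  then obtain \<epsilon> :: int where e: "\<epsilon> = 1 \<or> \<epsilon> = - 1" "s * t = c * r - \<epsilon> * n"
  proof
    assume "c * r - s * t = n"
    then show thesis by (intro that[of 1]) auto
  next
    assume "c * r - s * t = - n"
    then show thesis by (intro that[of "-1"]) auto
  qed
  have "(a * c + n) * (b * c + n) = (c * r - \<epsilon> * n)\<^sup>2"
    using sq(2,3) e(2) by (metis power_mult_distrib)
  also have "\<dots> = c\<^sup>2 * (a * b + n) - 2 * \<epsilon> * n * c * r + n\<^sup>2"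
    using e(1) unfolding sq(1) by (auto simp: power2_eq_square algebra_simps)
  finally have "n * c * (a + b) = n * c * (c - 2 * \<epsilon> * r)"
    by (simp add: power2_eq_square algebra_simps)
  then have abc: "c = a + b + 2 * \<epsilon> * r"
    using assms(1-4) by simp
  from e(1) show ?thesis
  proof
    assume "\<epsilon> = 1"
    then have c: "c = a + b + 2 * r" using abc by simp
    have "s\<^sup>2 = (a + r)\<^sup>2" "t\<^sup>2 = (b + r)\<^sup>2"
      using sq unfolding c by (simp_all add: power2_eq_square algebra_simps)
    then have "s = a + r" "t = b + r"
      using nonneg assms by (simp_all add: power2_eq_iff_nonneg)
    then show ?thesis using c by simp
  next
    assume "\<epsilon> = - 1"
    then have "a + b = c + 2 * r" using abc by simp
    with assms have "2 * r < a" by linarith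
    then have "(2 * r)\<^sup>2 < a\<^sup>2" using nonneg by (intro power_strict_mono) auto
    then have "4 * (a * b) + 4 * n < a * a"
      using sq(1) by (simp add: power2_eq_square algebra_simps)
    moreover have "a * a \<le> a * b" "b \<le> a * b"
      using assms by (auto simp: mult_left_mono)
    ultimately have "3 * b < 4 * \<bar>n\<bar>" by linarith
    moreover have "c \<le> a + b" using \<open>a + b = c + 2 * r\<close> nonneg by simp
    ultimately show ?thesis using assms by linarith
  qed
qed

text \<open>The number \<open>w = c r - s t\<close> satisfies \<open>c dvd w\<^sup>2 - n\<^sup>2\<close> and is at most about \<open>n c / r\<close> in size;
  so \<open>w\<^sup>2 = n\<^sup>2\<close> unless \<open>r\<close> is small compared to the square root of \<open>c\<close>.\<close>

lemma regular_or_small: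
  fixes a b c r s t n :: int
  assumes "n \<noteq> 0" "0 < a" "a < b" "b < c"
    and sq: "a * b + n = r\<^sup>2" "a * c + n = s\<^sup>2" "b * c + n = t\<^sup>2"
    and nonneg: "0 \<le> r" "0 \<le> s" "0 \<le> t"
    and c: "4 * \<bar>n\<bar> \<le> c" "n\<^sup>2 < c"
  shows "s + t = c \<or> r\<^sup>2 \<le> 4 * n\<^sup>2 * c"
proof (rule disjCI)
  assume small: "\<not> r\<^sup>2 \<le> 4 * n\<^sup>2 * c"
  define w where "w = c * r - s * t"
  \<comment> \<open>Multiplying by the conjugate removes the roots; the terms \<open>a b c^2\<close>
    cancel, so the right side is only of size \<open>n * c^2\<close>.\<close>
  have "w * (c * r + s * t) = c\<^sup>2 * r\<^sup>2 - s\<^sup>2 * t\<^sup>2"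
    by (simp add: w_def power2_eq_square algebra_simps)
  also have "\<dots> = n * (c * (c - a - b) - n)"
    unfolding sq[symmetric] by (simp add: power2_eq_square algebra_simps)
  finally have w: "w * (c * r + s * t) = n * (c * (c - a - b) - n)" .
  have size: "\<bar>c * (c - a - b) - n\<bar> \<le> 2 * (c * c)"
  proof -
    have "\<bar>c * (c - a - b)\<bar> \<le> c * c"
      unfolding abs_mult using assms by (intro mult_mono) auto
    moreover have "c \<le> c * c" using assms by (simp add: mult_left_mono)
    ultimately show ?thesis using c assms(1) by linarith
  qed
  have "\<bar>w\<bar> * (c * r + s * t) \<le> \<bar>n\<bar> * (2 * (c * c))"
  proof -
    have "\<bar>w\<bar> * (c * r + s * t) = \<bar>w * (c * r + s * t)\<bar>"
      using nonneg assms by (simp add: abs_mult)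
    also have "\<dots> = \<bar>n\<bar> * \<bar>c * (c - a - b) - n\<bar>" unfolding w abs_mult ..
    finally show ?thesis
      using size by (simp add: mult_left_mono)
  qed
  moreover have "\<bar>w\<bar> * (c * r) \<le> \<bar>w\<bar> * (c * r + s * t)"
    using nonneg by (intro mult_left_mono) auto
  ultimately have "c * (\<bar>w\<bar> * r) \<le> c * (2 * \<bar>n\<bar> * c)"
    by (simp add: algebra_simps)
  then have "\<bar>w\<bar> * r \<le> 2 * \<bar>n\<bar> * c" using assms by simp
  then have "(\<bar>w\<bar> * r)\<^sup>2 \<le> (2 * \<bar>n\<bar> * c)\<^sup>2"
    using nonneg by (intro power_mono) auto
  then have wr: "w\<^sup>2 * r\<^sup>2 \<le> 4 * n\<^sup>2 * c * c"
    by (simp add: power_mult_distrib power2_eq_square algebra_simps)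
  have "w\<^sup>2 - n\<^sup>2 = c * (c * r\<^sup>2 - 2 * r * s * t + a * b * c + n * (a + b))"
  proof -
    have "w\<^sup>2 = c\<^sup>2 * r\<^sup>2 - 2 * c * r * s * t + s\<^sup>2 * t\<^sup>2"
      by (simp add: w_def power2_eq_square algebra_simps)
    also have "s\<^sup>2 * t\<^sup>2 = (a * c + n) * (b * c + n)" using sq by simp
    finally show ?thesis by (simp add: power2_eq_square algebra_simps)
  qed
  then have dvd: "c dvd w\<^sup>2 - n\<^sup>2" by simp
  have "w\<^sup>2 = n\<^sup>2"
  proof (rule ccontr)
    \<comment> \<open>Divisibility and \<open>n^2 < c\<close> now give \<open>c \<le> w^2\<close>,
      and inserting this into the size bound for \<open>w r\<close> produces exactly the threshold
      \<open>4 * n^2 * c\<close> for \<open>r^2\<close>.\<close>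
    assume "w\<^sup>2 \<noteq> n\<^sup>2"
    then have "c \<le> \<bar>w\<^sup>2 - n\<^sup>2\<bar>" using dvd_imp_le_int[OF _ dvd] assms by simp
    moreover have "w\<^sup>2 \<ge> 0" "n\<^sup>2 \<ge> 0" by auto
    ultimately have "c \<le> w\<^sup>2" using c by linarith
    then have "c * r\<^sup>2 \<le> w\<^sup>2 * r\<^sup>2" by (intro mult_right_mono) auto
    with wr have "c * r\<^sup>2 \<le> c * (4 * n\<^sup>2 * c)" by (simp add: algebra_simps)
    then show False using small assms by simp
  qed
  then show "s + t = c"
    using regular_of_square_eq[OF assms(1-4) sq nonneg c(1)] by (simp add: w_def)
qed

text \<open>Two square roots of \<open>n\<close> modulo \<open>b\<close> that have the same greatest common divisor of \<open>t - s\<close>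
  and \<open>b\<close> agree modulo \<open>d\<close> and modulo \<open>b div d\<close>, where the common factor of these two
  moduli divides \<open>4 n\<close>.\<close>

lemma roots_same_gcd:
  fixes b s t t' n :: int
  assumes "0 < b" and s: "b dvd s\<^sup>2 - n" and t: "b dvd t\<^sup>2 - n" and t': "b dvd t'\<^sup>2 - n"
    and gcd: "gcd (t - s) b = gcd (t' - s) b"
  shows "b dvd 4 * n * (t - t')"
proof -
  define d where "d = gcd (t - s) b"
  have d: "d dvd t - s" "d dvd t' - s" "d dvd b" "d > 0"
  proof -
    show "d dvd t - s" "d dvd b" by (auto simp: d_def)
    show "d dvd t' - s" unfolding d_def gcd by simp
    show "d > 0" using assms(1) by (simp add: d_def gcd_pos_int)
  qed
  then obtain e where e: "b = d * e" by blast
  \<comment> \<open>As \<open>d\<close> is the whole common divisor of \<open>u - s\<close> and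
    \<open>b\<close>, the quotient \<open>(u - s) / d\<close> is coprime to
    \<open>e = b / d\<close>; so \<open>e\<close> must divide the other factor of
    \<open>u^2 - s^2\<close>.\<close>
  have plus: "e dvd u + s" if "gcd (u - s) b = d" "b dvd u\<^sup>2 - n" for u
  proof -
    have "b dvd (u\<^sup>2 - n) - (s\<^sup>2 - n)" using that s by (rule_tac dvd_diff)
    then have "b dvd (u - s) * (u + s)" by (simp add: power2_eq_square algebra_simps)
    moreover have "d dvd u - s" using that(1) by auto
    then obtain v where v: "u - s = d * v" by blast
    ultimately have "e dvd v * (u + s)" using d(4) by (simp add: e mult.assoc)
    moreover have "gcd (d * v) (d * e) = d" using that(1) v e by simp
    then have "coprime v e"
      using d(4) by (simp add: gcd_mult_left coprime_iff_gcd_eq_1)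
    ultimately show ?thesis by (simp add: coprime_commute coprime_dvd_mult_right_iff)
  qed
  have "e dvd t + s" "e dvd t' + s" using plus gcd t t' by (auto simp: d_def)
  then have etl: "e dvd t - t'" using dvd_diff[of e "t + s" "t' + s"] by simp
  have dtl: "d dvd t - t'" using d dvd_diff[of d "t - s" "t' - s"] by simp
  define g where "g = gcd d e"
  have "lcm d e dvd t - t'" using etl dtl by simp
  then have "g * lcm d e dvd g * (t - t')" by simp
  moreover have "g * lcm d e = b"
  proof -
    have "e \<ge> 0" using e d(4) assms(1) by (simp add: zero_less_mult_iff)
    then show ?thesis using d(4) by (simp add: g_def e prod_gcd_lcm_int[symmetric])
  qed
  ultimately have "b dvd g * (t - t')" by simp
  \<comment> \<open>\<open>g\<close> divides both \<open>t - s\<close> and \<open>t + s\<close>,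
    hence \<open>2 s\<close>, while \<open>4 s^2\<close> is congruent to \<open>4 n\<close> modulo
    \<open>b\<close>.\<close>
  moreover have "g dvd 4 * n"
  proof -
    have "g dvd t - s" "g dvd t + s"
      using d \<open>e dvd t + s\<close> by (auto simp: g_def intro: dvd_trans)
    then have "g dvd (t + s) - (t - s)" by (rule_tac dvd_diff)
    then have "g dvd 2 * s" by simp
    then have "g dvd 4 * s\<^sup>2" using dvd_mult[of g "2 * s" "2 * s"] by (simp add: power2_eq_square)
    moreover have "g dvd b" using d(3) by (auto simp: g_def intro: dvd_trans)
    then have "g dvd 4 * (s\<^sup>2 - n)" using s by (meson dvd_mult dvd_trans)
    ultimately have "g dvd 4 * s\<^sup>2 - 4 * (s\<^sup>2 - n)" by (rule dvd_diff)
    then show ?thesis by (simp add: algebra_simps)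
  qed
  ultimately show ?thesis by (meson dvd_trans mult_dvd_mono dvd_refl)
qed

text \<open>Fix one root \<open>s\<close> and classify the roots \<open>t\<close> by
  \<open>gcd (t - s) b\<close>, a divisor of \<open>b\<close>. Within a class
  \<open>4 * \<bar>n\<bar> * t\<close> is constant modulo \<open>b\<close>, so the quotient of
  \<open>4 * \<bar>n\<bar> * t\<close> by \<open>b\<close> determines \<open>t\<close>.\<close>

lemma card_roots_le:
  fixes b n L :: int
  assumes "0 < b" "0 \<le> L" "n \<noteq> 0"
  shows "card {t. 0 \<le> t \<and> t \<le> L \<and> b dvd t\<^sup>2 - n}
    \<le> card {d. d dvd nat b} * nat (4 * \<bar>n\<bar> * L div b + 1)"
proof (cases "{t. 0 \<le> t \<and> t \<le> L \<and> b dvd t\<^sup>2 - n} = {}")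
  case False
  then obtain s where s: "b dvd s\<^sup>2 - n" by blast
  let ?T = "{t. 0 \<le> t \<and> t \<le> L \<and> b dvd t\<^sup>2 - n}"
  define f where "f = (\<lambda>t. (nat (gcd (t - s) b), nat (4 * \<bar>n\<bar> * t div b)))"
  have "inj_on f ?T"
  proof (rule inj_onI)
    fix t t' assume "t \<in> ?T" "t' \<in> ?T" and "f t = f t'"
    then have t: "b dvd t\<^sup>2 - n" "b dvd t'\<^sup>2 - n" "0 \<le> t" "0 \<le> t'" by auto
    with \<open>f t = f t'\<close> have "gcd (t - s) b = gcd (t' - s) b" and div: "4 * \<bar>n\<bar> * t div b = 4 * \<bar>n\<bar> * t' div b"
      using assms by (auto simp: f_def nat_eq_iff pos_imp_zdiv_nonneg_iff)
    then have "b dvd 4 * n * (t - t')" using roots_same_gcd assms(1) s t by blast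
    then have "b dvd 4 * \<bar>n\<bar> * (t - t')" by (cases "n \<ge> 0") auto
    then have "4 * \<bar>n\<bar> * t mod b = 4 * \<bar>n\<bar> * t' mod b"
      by (simp add: mod_eq_dvd_iff right_diff_distrib)
    with div have "4 * \<bar>n\<bar> * t = 4 * \<bar>n\<bar> * t'" by (metis div_mult_mod_eq)
    then show "t = t'" using assms(3) by simp
  qed
  moreover have "f ` ?T \<subseteq> {d. d dvd nat b} \<times> {..<nat (4 * \<bar>n\<bar> * L div b + 1)}"
  proof (rule image_subsetI)
    fix t assume "t \<in> ?T"
    then have t: "0 \<le> t" "t \<le> L" by auto
    have "4 * \<bar>n\<bar> * t div b \<le> 4 * \<bar>n\<bar> * L div b"
      using assms t by (intro zdiv_mono1 mult_left_mono) auto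
    moreover have "0 \<le> 4 * \<bar>n\<bar> * t div b" using assms t by (simp add: pos_imp_zdiv_nonneg_iff)
    ultimately have "nat (4 * \<bar>n\<bar> * t div b) < nat (4 * \<bar>n\<bar> * L div b + 1)" by linarith
    moreover have "nat (gcd (t - s) b) dvd nat b"
    proof -
      have "int (nat (gcd (t - s) b)) dvd int (nat b)" using assms(1) by simp
      then show ?thesis by (simp only: of_nat_dvd_iff)
    qed
    ultimately show "f t \<in> {d. d dvd nat b} \<times> {..<nat (4 * \<bar>n\<bar> * L div b + 1)}"
      by (simp add: f_def)
  qed
  moreover have "finite ({d. d dvd nat b} \<times> {..<nat (4 * \<bar>n\<bar> * L div b + 1)})"
    using assms(1) by auto
  ultimately have "card ?T \<le> card ({d. d dvd nat b} \<times> {..<nat (4 * \<bar>n\<bar> * L div b + 1)})"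
    by (intro card_inj_on_le)
  then show ?thesis by (simp add: card_cartesian_product)
qed (simp only: card.empty zero_le)

section \<open>Pairs and triples as square roots\<close>

definition root_pairs :: "int \<Rightarrow> nat \<Rightarrow> (int \<times> int) set" where
  "root_pairs n N = {(c, r). 1 \<le> c \<and> c \<le> int N \<and> 0 \<le> r \<and> r < c \<and> c dvd r\<^sup>2 - n}"

text \<open>The margin \<open>\<bar>n\<bar> + 1\<close> forces \<open>0 < (r\<^sup>2 - n) / c < c\<close> and excludes \<open>c = 2 r\<close>.\<close>

definition inner_pairs :: "int \<Rightarrow> nat \<Rightarrow> (int \<times> int) set" where
  "inner_pairs n N = {(c, r) \<in> root_pairs n N. \<bar>n\<bar> + 1 < r \<and> r + (\<bar>n\<bar> + 1) < c}"

text \<open>A triple \<open>a < b < c\<close> is encoded by its middle element \<open>b\<close> together with \<open>r\<close>, \<open>t\<close>, where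
  \<open>a b + n = r\<^sup>2\<close> and \<open>b c + n = t\<^sup>2\<close>.\<close>

definition irregular_params :: "int \<Rightarrow> nat \<Rightarrow> (int \<times> int \<times> int) set" where
  "irregular_params n N = {(r, b, t). 0 \<le> r \<and> r\<^sup>2 \<le> 4 * n\<^sup>2 * int N \<and> r\<^sup>2 \<noteq> n \<and>
     1 \<le> b \<and> b \<le> int N \<and> r\<^sup>2 \<le> (1 + \<bar>n\<bar>) * b\<^sup>2 \<and> b dvd r\<^sup>2 - n \<and>
     0 \<le> t \<and> t\<^sup>2 \<le> b * int N + \<bar>n\<bar> \<and> b dvd t\<^sup>2 - n}"

definition cofactor :: "int \<Rightarrow> int \<Rightarrow> int \<Rightarrow> int" where
  "cofactor n c r = (r\<^sup>2 - n) div c"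

lemma finite_root_pairs [simp]: "finite (root_pairs n N)"
  by (rule finite_subset[of _ "{0..int N} \<times> {0..int N}"]) (auto simp: root_pairs_def)

lemma finite_inner_pairs [simp]: "finite (inner_pairs n N)"
  by (rule finite_subset[OF _ finite_root_pairs[of n N]]) (auto simp: inner_pairs_def)

section \<open>Cofactors and the reflection of roots\<close>

lemma cofactor_eqI: "0 < c \<Longrightarrow> a * c + n = r\<^sup>2 \<Longrightarrow> cofactor n c r = a"
  by (metis add_diff_cancel_right' cofactor_def less_irrefl nonzero_mult_div_cancel_right)

lemma cofactor_mult: "c dvd r\<^sup>2 - n \<Longrightarrow> cofactor n c r * c + n = r\<^sup>2"
  by (simp add: cofactor_def)

lemma inner_pairs_reflect:
  assumes "(c, r) \<in> inner_pairs n N"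
  shows "(c, c - r) \<in> inner_pairs n N"
proof -
  have "(c - r)\<^sup>2 - n = c * (c - 2 * r) + (r\<^sup>2 - n)"
    by (simp add: power2_eq_square algebra_simps)
  then have "c dvd (c - r)\<^sup>2 - n"
    using assms by (simp only: inner_pairs_def root_pairs_def mem_Collect_eq prod.case dvd_add dvd_triv_left)
  then show ?thesis
    using assms by (auto simp: inner_pairs_def root_pairs_def)
qed

lemma inner_pairs_cofactor:
  assumes "(c, r) \<in> inner_pairs n N"
  shows "0 < cofactor n c r" "cofactor n c r < c" "cofactor n c r * c + n = r\<^sup>2" "c \<le> int N"
proof -
  define j where "j = \<bar>n\<bar> + 1"
  have c: "0 < c" "c dvd r\<^sup>2 - n" "j < r" "r + j < c" "c \<le> int N"
    using assms by (auto simp: inner_pairs_def root_pairs_def j_def)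
  show eq: "cofactor n c r * c + n = r\<^sup>2" using c cofactor_mult by blast
  show "c \<le> int N" by fact
  have "1 * r \<le> r * r" using c by (intro mult_right_mono) (auto simp: j_def)
  then have "n < r\<^sup>2" using c by (simp add: power2_eq_square j_def)
  then have "0 < cofactor n c r * c" using eq by linarith
  then show "0 < cofactor n c r" using c by (simp add: zero_less_mult_iff)
  \<comment> \<open>The gap of one between \<open>r\<close> and \<open>c\<close> leaves room for
    \<open>2 r\<close>, which exceeds \<open>\<bar>n\<bar>\<close> and so absorbs \<open>- n\<close>
    when \<open>n\<close> is negative.\<close>
  have "(r + 1) * (r + 1) \<le> c * c" using c by (intro mult_mono) (auto simp: j_def)
  then have "r\<^sup>2 + 2 * r < c * c" by (simp add: power2_eq_square algebra_simps)
  then have "cofactor n c r * c < c * c" using eq c unfolding j_def by linarith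
  then show "cofactor n c r < c" using c by simp
qed

text \<open>A fixed point \<open>r = c - r\<close> of the reflection would make \<open>r\<close>
  divide the non-zero \<open>n\<close>, although \<open>r > \<bar>n\<bar>\<close>.\<close>

lemma inner_pairs_not_double:
  assumes "n \<noteq> 0" "(c, r) \<in> inner_pairs n N"
  shows "2 * r \<noteq> c"
proof
  assume "2 * r = c"
  then have "2 * r dvd r\<^sup>2 - n" "\<bar>n\<bar> < r"
    using assms by (auto simp: inner_pairs_def root_pairs_def)
  then have "r dvd r\<^sup>2 - n" by (meson dvd_mult_right)
  then have "r dvd r\<^sup>2 - (r\<^sup>2 - n)" by (rule dvd_diff[rotated]) (simp_all add: power2_eq_square)
  then have "r dvd n" by simp
  then have "\<bar>r\<bar> \<le> \<bar>n\<bar>" using assms(1) dvd_imp_le_int by blast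
  with \<open>\<bar>n\<bar> < r\<close> show False by simp
qed

lemma cofactor_reflect:
  assumes "0 < c" "c dvd r\<^sup>2 - n"
  shows "cofactor n c (c - r) = cofactor n c r + c - 2 * r"
proof (rule cofactor_eqI)
  show "(cofactor n c r + c - 2 * r) * c + n = (c - r)\<^sup>2"
    using cofactor_mult[OF assms(2)] by (simp add: power2_eq_square algebra_simps)
qed fact

lemma cofactor_reflect_square:
  assumes "0 < c" "c dvd r\<^sup>2 - n"
  shows "cofactor n c r * cofactor n c (c - r) + n = (r - cofactor n c r)\<^sup>2"
  using cofactor_mult[OF assms(2)] unfolding cofactor_reflect[OF assms]
  by (simp add: power2_eq_square algebra_simps)

section \<open>Ordered integer coordinates for pairs and triples\<close>

lemma is_squareE_nonneg:
  fixes x :: int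
  assumes "is_square x"
  obtains r where "0 \<le> r" "x = r\<^sup>2"
proof -
  from assms obtain r where "x = r\<^sup>2" by (auto simp: is_nth_power_def)
  then have "x = \<bar>r\<bar>\<^sup>2" by simp
  then show thesis using that abs_ge_zero by blast
qed

lemma D_pairE:
  assumes "D_tuple n 2 A"
  obtains a c r where "0 < a" "a < c" "A = {nat a, nat c}" "0 \<le> r" "a * c + n = r\<^sup>2"
proof -
  obtain x y where xy: "A = {x, y}" "x \<noteq> y"
    using assms by (auto simp: D_tuple_def card_2_iff)
  define u v where "u = min x y" and "v = max x y"
  have A: "A = {u, v}" "u < v" using xy by (auto simp: u_def v_def min_def max_def)
  then have "0 < u" "is_square (int u * int v + n)"
    using assms by (auto simp: D_tuple_def)
  then obtain r where "0 \<le> r" "int u * int v + n = r\<^sup>2" by (elim is_squareE_nonneg)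
  with A \<open>0 < u\<close> show thesis by (intro that[of "int u" "int v" r]) auto
qed

lemma D_tripleE:
  assumes "D_tuple n 3 A"
  obtains a b c r s t where "0 < a" "a < b" "b < c" "A = {nat a, nat b, nat c}"
    "0 \<le> r" "0 \<le> s" "0 \<le> t" "a * b + n = r\<^sup>2" "a * c + n = s\<^sup>2" "b * c + n = t\<^sup>2"
proof -
  have A: "finite A" "card A = 3" using assms by (auto simp: D_tuple_def)
  define xs where "xs = sorted_list_of_set A"
  have xs: "sorted_wrt (<) xs" "set xs = A" "length xs = 3"
    using A by (auto simp: xs_def)
  then obtain u v w where "xs = [u, v, w]"
    by (auto simp: length_Suc_conv numeral_3_eq_3)
  with xs have uvw: "A = {u, v, w}" "u < v" "v < w" by auto
  then have pos: "0 < u" and "is_square (int u * int v + n)" "is_square (int u * int w + n)"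
    "is_square (int v * int w + n)"
    using assms by (auto simp: D_tuple_def)
  then obtain r s t where "0 \<le> r" "int u * int v + n = r\<^sup>2" "0 \<le> s" "int u * int w + n = s\<^sup>2"
    "0 \<le> t" "int v * int w + n = t\<^sup>2"
    by (elim is_squareE_nonneg)
  with uvw pos show thesis by (intro that[of "int u" "int v" "int w" r s t]) auto
qed

lemma D_tuple_pairI:
  assumes "0 < a" "a < c" "a * c + n = r\<^sup>2"
  shows "D_tuple n 2 {nat a, nat c}"
proof -
  have "nat a \<noteq> nat c" using assms by auto
  moreover have "is_square (a * c + n)" "is_square (c * a + n)"
    using assms(3) by (auto simp: mult.commute)
  ultimately show ?thesis
    using assms(1,2) by (auto simp: D_tuple_def)
qed

lemma D_tuple_tripleI:
  assumes "0 < a" "a < b" "b < c" "a * b + n = r\<^sup>2" "a * c + n = s\<^sup>2" "b * c + n = t\<^sup>2"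
  shows "D_tuple n 3 {nat a, nat b, nat c}"
proof -
  have "nat a \<noteq> nat b" "nat a \<noteq> nat c" "nat b \<noteq> nat c" using assms by auto
  moreover have "is_square (a * b + n)" "is_square (b * a + n)" "is_square (a * c + n)"
    "is_square (c * a + n)" "is_square (b * c + n)" "is_square (c * b + n)"
    using assms(4-6) by (auto simp: mult.commute)
  ultimately show ?thesis
    using assms(1-3) by (auto simp: D_tuple_def)
qed

lemma finite_D_sets [simp]: "finite {A. A \<subseteq> {1..N} \<and> D_tuple n m A}"
  by (rule finite_subset[of _ "Pow {1..N}"]) auto

section \<open>Counting pairs and regular triples\<close>

lemma card_inner_pairs_le_D_count:
  "card (inner_pairs n N) \<le> D_count 2 n N"
proof -
  define g where "g = (\<lambda>(c, r). {nat (cofactor n c r), nat c})"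
  have "inj_on g (inner_pairs n N)"
  proof (rule inj_onI)
    fix p p' assume p: "p \<in> inner_pairs n N" "p' \<in> inner_pairs n N" "g p = g p'"
    obtain c r c' r' where pp: "p = (c, r)" "p' = (c', r')" by fastforce
    note 1 = inner_pairs_cofactor[OF p(1)[unfolded pp]] inner_pairs_cofactor[OF p(2)[unfolded pp]]
    have "{nat (cofactor n c r), nat c} = {nat (cofactor n c' r'), nat c'}"
      using p(3) by (simp add: g_def pp)
    with 1 have "c = c'" "cofactor n c r = cofactor n c' r'"
      by (auto simp: doubleton_eq_iff)
    with 1 have "r\<^sup>2 = r'\<^sup>2" by metis
    moreover have "0 \<le> r" "0 \<le> r'" using p by (auto simp: pp inner_pairs_def)
    ultimately show "p = p'" using \<open>c = c'\<close> pp by (simp add: power2_eq_iff_nonneg)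
  qed
  moreover have "g ` inner_pairs n N \<subseteq> {A. A \<subseteq> {1..N} \<and> D_tuple n 2 A}"
  proof (rule image_subsetI)
    fix p assume p: "p \<in> inner_pairs n N"
    obtain c r where pp: "p = (c, r)" by fastforce
    note 1 = inner_pairs_cofactor[OF p[unfolded pp]]
    show "g p \<in> {A. A \<subseteq> {1..N} \<and> D_tuple n 2 A}"
      using 1 D_tuple_pairI[OF 1(1,2,3)] by (auto simp: g_def pp)
  qed
  ultimately show ?thesis
    unfolding D_count_def by (intro card_inj_on_le[of g]) auto
qed

text \<open>If the larger element satisfies \<open>c > \<bar>n\<bar>\<close>, then
  \<open>a c + n \<le> (c - 1) c + n < c^2\<close>, so \<open>r < c\<close> and the pair comes from
  a root. The remaining pairs are subsets of a fixed finite set, counted crudely by its power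
  set.\<close>

lemma D_count_2_le:
  "D_count 2 n N \<le> card (root_pairs n N) + 2 ^ nat \<bar>n\<bar>"
proof -
  define g where "g = (\<lambda>(c, r). {nat (cofactor n c r), nat c})"
  have "{A. A \<subseteq> {1..N} \<and> D_tuple n 2 A} \<subseteq> g ` root_pairs n N \<union> Pow {1..nat \<bar>n\<bar>}"
  proof (rule subsetI, rule UnCI)
    fix A assume "A \<in> {A. A \<subseteq> {1..N} \<and> D_tuple n 2 A}" "A \<notin> Pow {1..nat \<bar>n\<bar>}"
    then have A: "A \<subseteq> {1..N}" "D_tuple n 2 A" "\<not> A \<subseteq> {1..nat \<bar>n\<bar>}" by auto
    obtain a c r where acr: "0 < a" "a < c" "A = {nat a, nat c}" "0 \<le> r" "a * c + n = r\<^sup>2"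
      using D_pairE[OF A(2)] .
    then have c: "\<bar>n\<bar> < c" "c \<le> int N" using A by auto
    have "a * c \<le> (c - 1) * c" using acr by (intro mult_right_mono) auto
    then have "r\<^sup>2 < c\<^sup>2" using acr c by (simp add: power2_eq_square algebra_simps)
    then have "r < c" using acr by (meson less_trans power_less_imp_less_base less_imp_le)
    moreover have "r\<^sup>2 - n = c * a" using acr by (simp add: algebra_simps)
    ultimately have "(c, r) \<in> root_pairs n N" using acr c by (simp add: root_pairs_def)
    moreover have "g (c, r) = A" using acr cofactor_eqI[of c a n r] by (simp add: g_def)
    ultimately show "A \<in> g ` root_pairs n N" by (metis imageI)
  qed
  then have "D_count 2 n N \<le> card (g ` root_pairs n N \<union> Pow {1..nat \<bar>n\<bar>})"
    unfolding D_count_def by (intro card_mono) auto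
  also have "\<dots> \<le> card (g ` root_pairs n N) + card (Pow {1..nat \<bar>n\<bar>})" by (rule card_Un_le)
  also have "\<dots> \<le> card (root_pairs n N) + 2 ^ nat \<bar>n\<bar>"
    by (intro add_mono card_image_le) (auto simp: card_Pow)
  finally show ?thesis .
qed

text \<open>One representative of each orbit of the reflection
  \<open>r \<mapsto> c - r\<close>.\<close>

definition half_pairs :: "int \<Rightarrow> nat \<Rightarrow> (int \<times> int) set" where
  "half_pairs n N = {(c, r) \<in> inner_pairs n N. 2 * r < c}"

lemma finite_half_pairs [simp]: "finite (half_pairs n N)"
  by (rule finite_subset[OF _ finite_inner_pairs[of n N]]) (auto simp: half_pairs_def)

text \<open>The reflection is an involution without fixed points on the inner pairs. This is the
  source of the factor \<open>1/2\<close> in the theorem.\<close>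

lemma card_inner_pairs:
  assumes "n \<noteq> 0"
  shows "card (inner_pairs n N) = 2 * card (half_pairs n N)"
proof -
  define f where "f = (\<lambda>(c :: int, r). (c, c - r))"
  have "inner_pairs n N = half_pairs n N \<union> f ` half_pairs n N"
  proof
    show "inner_pairs n N \<subseteq> half_pairs n N \<union> f ` half_pairs n N"
    proof
      fix p assume p: "p \<in> inner_pairs n N"
      obtain c r where pp: "p = (c, r)" by fastforce
      have "2 * r < c \<or> 2 * (c - r) < c"
        using inner_pairs_not_double[OF assms] p pp by fastforce
      then show "p \<in> half_pairs n N \<union> f ` half_pairs n N"
        using p inner_pairs_reflect[of c r n N] unfolding pp
        by (auto simp: half_pairs_def f_def intro!: image_eqI[of _ _ "(c, c - r)"])
    qed
    show "half_pairs n N \<union> f ` half_pairs n N \<subseteq> inner_pairs n N"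
      using inner_pairs_reflect by (auto simp: half_pairs_def f_def)
  qed
  moreover have "half_pairs n N \<inter> f ` half_pairs n N = {}"
    by (auto simp: half_pairs_def f_def)
  moreover have "inj_on f (half_pairs n N)"
    by (auto simp: f_def inj_on_def)
  ultimately show ?thesis
    by (simp add: card_Un_disjoint card_image)
qed

lemma half_pairs_cofactors:
  assumes "(c, r) \<in> half_pairs n N"
  shows "cofactor n c r < cofactor n c (c - r)"
    "0 < cofactor n c r" "cofactor n c (c - r) < c"
    "cofactor n c r * cofactor n c (c - r) + n = (r - cofactor n c r)\<^sup>2"
    "cofactor n c r * c + n = r\<^sup>2"
    "cofactor n c (c - r) * c + n = (c - r)\<^sup>2" "c \<le> int N"
proof -
  have 1: "(c, r) \<in> inner_pairs n N" "2 * r < c" using assms by (auto simp: half_pairs_def)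
  have 2: "0 < c" "c dvd r\<^sup>2 - n" using 1 by (auto simp: inner_pairs_def root_pairs_def)
  \<comment> \<open>The difference of the two cofactors is \<open>c - 2 r\<close>, so choosing the
    smaller root orders the triple.\<close>
  show "cofactor n c r < cofactor n c (c - r)"
    using cofactor_reflect[OF 2] 1(2) by simp
  show "0 < cofactor n c r" "cofactor n c r * c + n = r\<^sup>2" "c \<le> int N"
    using inner_pairs_cofactor[OF 1(1)] by auto
  show "cofactor n c (c - r) < c" "cofactor n c (c - r) * c + n = (c - r)\<^sup>2"
    using inner_pairs_cofactor[OF inner_pairs_reflect[OF 1(1)]] by auto
  show "cofactor n c r * cofactor n c (c - r) + n = (r - cofactor n c r)\<^sup>2"
    by (rule cofactor_reflect_square[OF 2])
qed

definition regular_triple :: "int \<Rightarrow> int \<times> int \<Rightarrow> nat set" where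
  "regular_triple n = (\<lambda>(c, r). {nat (cofactor n c r), nat (cofactor n c (c - r)), nat c})"

lemma card_half_pairs_le_D_count:
  "card (half_pairs n N) \<le> D_count 3 n N"
proof -
  have "inj_on (regular_triple n) (half_pairs n N)"
  proof (rule inj_onI)
    fix p p' assume p: "p \<in> half_pairs n N" "p' \<in> half_pairs n N"
      and eq: "regular_triple n p = regular_triple n p'"
    obtain c r c' r' where pp: "p = (c, r)" "p' = (c', r')" by fastforce
    note 1 = half_pairs_cofactors[OF p(1)[unfolded pp]]
    note 2 = half_pairs_cofactors[OF p(2)[unfolded pp]]
    \<comment> \<open>The triple is ordered as \<open>a < b < c\<close>, so its maximum and minimum
      return \<open>c\<close> and \<open>a\<close>, and these determine \<open>r\<close>.\<close>
    have Max: "Max (regular_triple n p) = nat c" "Max (regular_triple n p') = nat c'"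
      using 1 2 by (auto simp: regular_triple_def pp)
    have Min: "Min (regular_triple n p) = nat (cofactor n c r)"
      "Min (regular_triple n p') = nat (cofactor n c' r')"
      using 1 2 by (auto simp: regular_triple_def pp)
    have "nat c = nat c'" "nat (cofactor n c r) = nat (cofactor n c' r')"
      using Max Min eq by simp_all
    with 1 2 have "c = c'" "cofactor n c r = cofactor n c' r'" by auto
    with 1(5) 2(5) have "r\<^sup>2 = r'\<^sup>2" by metis
    moreover have "0 \<le> r" "0 \<le> r'" using p by (auto simp: pp half_pairs_def inner_pairs_def)
    ultimately show "p = p'" using \<open>c = c'\<close> pp by (simp add: power2_eq_iff_nonneg)
  qed
  moreover have "regular_triple n ` half_pairs n N \<subseteq> {A. A \<subseteq> {1..N} \<and> D_tuple n 3 A}"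
  proof (rule image_subsetI)
    fix p assume p: "p \<in> half_pairs n N"
    obtain c r where pp: "p = (c, r)" by fastforce
    note 1 = half_pairs_cofactors[OF p[unfolded pp]]
    show "regular_triple n p \<in> {A. A \<subseteq> {1..N} \<and> D_tuple n 3 A}"
      using 1 D_tuple_tripleI[OF 1(2,1,3,4,5,6)] by (auto simp: regular_triple_def pp)
  qed
  ultimately show ?thesis
    unfolding D_count_def by (intro card_inj_on_le[of "regular_triple n"]) auto
qed

section \<open>Classification of all triples\<close>

lemma finite_irregular_params [simp]: "finite (irregular_params n N)"
proof (rule finite_subset)
  show "irregular_params n N \<subseteq> {0..4 * n\<^sup>2 * int N} \<times> {0..int N} \<times> {0..int N * int N + \<bar>n\<bar>}"
  proof clarsimp
    fix r b t assume "(r, b, t) \<in> irregular_params n N"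
    then have *: "0 \<le> r" "r\<^sup>2 \<le> 4 * n\<^sup>2 * int N" "1 \<le> b" "b \<le> int N" "0 \<le> t" "t\<^sup>2 \<le> b * int N + \<bar>n\<bar>"
      by (auto simp: irregular_params_def)
    have le: "x \<le> x\<^sup>2" if "0 \<le> x" for x :: int
      using that self_le_power[of x 2] by (cases "x = 0") auto
    have "b * int N \<le> int N * int N" using * by (intro mult_right_mono) auto
    then show "0 \<le> r \<and> r \<le> 4 * n\<^sup>2 * int N \<and> 0 \<le> b \<and> b \<le> int N \<and> 0 \<le> t \<and> t \<le> int N * int N + \<bar>n\<bar>"
      using * le[of r] le[of t] by linarith
  qed
qed auto

text \<open>The value \<open>K\<close> is large enough that \<open>c > K\<close> implies both size
  hypotheses of \<open>regular_or_small\<close> and also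
  \<open>c - \<bar>n\<bar> > (\<bar>n\<bar> + 1)^2\<close>. The latter puts \<open>s\<close>, and
  with it the larger \<open>t\<close>, beyond the margin of the inner pairs, so
  \<open>s + t = c\<close> makes \<open>(c, s)\<close> a half pair with reflected root
  \<open>t\<close>.\<close>

lemma D_triple_cases:
  assumes "n \<noteq> 0" "A \<subseteq> {1..N}" "D_tuple n 3 A"
  defines "K \<equiv> nat ((\<bar>n\<bar> + 2)\<^sup>2 + 4 * \<bar>n\<bar>)"
  shows "A \<subseteq> {1..K} \<or> A \<in> regular_triple n ` half_pairs n N \<or>
    A \<in> (\<lambda>(r, b, t). {nat (cofactor n b r), nat b, nat (cofactor n b t)}) ` irregular_params n N"
proof -
  obtain a b c r s t where abc: "0 < a" "a < b" "b < c" "A = {nat a, nat b, nat c}"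
    and nonneg: "0 \<le> r" "0 \<le> s" "0 \<le> t"
    and sq: "a * b + n = r\<^sup>2" "a * c + n = s\<^sup>2" "b * c + n = t\<^sup>2"
    using D_tripleE[OF assms(3)] .
  have cN: "c \<le> int N" using abc assms(2) by auto
  show ?thesis
  proof (cases "c \<le> int K")
    case True
    then show ?thesis using abc by auto
  next
    case False
    then have "(\<bar>n\<bar> + 2)\<^sup>2 + 4 * \<bar>n\<bar> < c" by (simp add: K_def)
    moreover have "(\<bar>n\<bar> + 2)\<^sup>2 = n\<^sup>2 + 4 * \<bar>n\<bar> + 4" "(\<bar>n\<bar> + 1)\<^sup>2 = n\<^sup>2 + 2 * \<bar>n\<bar> + 1" "0 \<le> n\<^sup>2"
      by (simp_all add: power2_eq_square algebra_simps)
    ultimately have c: "4 * \<bar>n\<bar> \<le> c" "n\<^sup>2 < c" "(\<bar>n\<bar> + 1)\<^sup>2 + \<bar>n\<bar> < c"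
      by linarith+
    consider "s + t = c" | "r\<^sup>2 \<le> 4 * n\<^sup>2 * c"
      using regular_or_small[OF assms(1) abc(1-3) sq nonneg c(1,2)] by blast
    then show ?thesis
    proof cases
      case 1
      have "1 * c \<le> a * c" using abc by (intro mult_right_mono) auto
      then have "(\<bar>n\<bar> + 1)\<^sup>2 < s\<^sup>2" using sq c by linarith
      then have s: "\<bar>n\<bar> + 1 < s" using nonneg by (meson power_less_imp_less_base)
      have "a * c < b * c" using abc by simp
      then have "s\<^sup>2 < t\<^sup>2" using sq by linarith
      then have st: "s < t" using nonneg by (meson power_less_imp_less_base)
      have "c dvd s\<^sup>2 - n" using sq by (metis add_diff_cancel_right' dvd_triv_right)
      then have "(c, s) \<in> half_pairs n N"
        using 1 s st cN abc nonneg by (auto simp: half_pairs_def inner_pairs_def root_pairs_def)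
      moreover have "regular_triple n (c, s) = A"
      proof -
        have "c - s = t" using 1 by simp
        then show ?thesis
          using abc sq cofactor_eqI[of c a n s] cofactor_eqI[of c b n t]
          by (simp add: regular_triple_def)
      qed
      ultimately show ?thesis by blast
    next
      case 2
      have "r\<^sup>2 \<le> 4 * n\<^sup>2 * int N" using 2 cN by (smt (verit) mult_left_mono zero_le_power2)
      \<comment> \<open>This guarantees that \<open>b\<close> divides a non-zero number, so that the
        divisor bound can later count the \<open>b\<close> belonging to a given
        \<open>r\<close>.\<close>
      moreover have "0 < a * b" using abc by simp
      then have "r\<^sup>2 \<noteq> n" using sq by linarith
      moreover have "r\<^sup>2 \<le> (1 + \<bar>n\<bar>) * b\<^sup>2"
      proof -
        have "a * b \<le> b * b" using abc by (intro mult_right_mono) auto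
        moreover have "\<bar>n\<bar> * 1 \<le> \<bar>n\<bar> * b\<^sup>2" using abc by (intro mult_left_mono) auto
        ultimately show ?thesis using sq by (simp add: power2_eq_square algebra_simps)
      qed
      moreover have "b * c \<le> b * int N" using abc cN by simp
      then have "t\<^sup>2 \<le> b * int N + \<bar>n\<bar>" using sq by linarith
      moreover have "b dvd r\<^sup>2 - n" "b dvd t\<^sup>2 - n"
        using sq by (metis add_diff_cancel_right' dvd_triv_right, metis add_diff_cancel_right' dvd_triv_left)
      ultimately have mem: "(r, b, t) \<in> irregular_params n N"
        using abc nonneg cN by (simp add: irregular_params_def)
      have "cofactor n b r = a" "cofactor n b t = c"
        using abc sq by (auto intro!: cofactor_eqI simp: mult.commute)
      with mem abc(4) show ?thesis by (intro disjI2 image_eqI[of _ _ "(r, b, t)"]) simp_all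
    qed
  qed
qed

lemma D_count_3_le:
  assumes "n \<noteq> 0"
  shows "D_count 3 n N \<le> card (half_pairs n N) + card (irregular_params n N)
    + 2 ^ nat ((\<bar>n\<bar> + 2)\<^sup>2 + 4 * \<bar>n\<bar>)"
proof -
  define K where "K = nat ((\<bar>n\<bar> + 2)\<^sup>2 + 4 * \<bar>n\<bar>)"
  define h where "h = (\<lambda>(r, b, t). {nat (cofactor n b r), nat b, nat (cofactor n b t)})"
  have "{A. A \<subseteq> {1..N} \<and> D_tuple n 3 A} \<subseteq>
      (regular_triple n ` half_pairs n N \<union> h ` irregular_params n N) \<union> Pow {1..K}"
    using D_triple_cases[OF assms] by (auto simp: h_def K_def)
  then have "D_count 3 n N \<le>
      card ((regular_triple n ` half_pairs n N \<union> h ` irregular_params n N) \<union> Pow {1..K})"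
    unfolding D_count_def by (intro card_mono) auto
  also have "\<dots> \<le> card (regular_triple n ` half_pairs n N) + card (h ` irregular_params n N) + card (Pow {1..K})"
    by (meson add_le_mono card_Un_le le_refl le_trans)
  also have "\<dots> \<le> card (half_pairs n N) + card (irregular_params n N) + 2 ^ K"
    by (intro add_mono card_image_le) (auto simp: card_Pow)
  finally show ?thesis by (simp add: K_def)
qed

section \<open>Irregular triples\<close>

lemma sum_int_inverse_sqrt_le:
  "(\<Sum>r\<in>{0..int R}. 1 / sqrt (of_int r + 1)) \<le> 2 * sqrt (real R + 1)"
proof -
  have "(\<Sum>r\<in>{0..int R}. 1 / sqrt (of_int r + 1)) = (\<Sum>i=1..Suc R. 1 / sqrt (real i))"
    by (rule sum.reindex_bij_witness[of _ "\<lambda>i. int i - 1" "\<lambda>r. nat (r + 1)"]) auto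
  also have "\<dots> \<le> 2 * sqrt (real (Suc R))" by (rule sum_inverse_sqrt_le)
  finally show ?thesis by (simp add: add.commute)
qed

text \<open>The roots reach up to about \<open>sqrt (b * N)\<close>, so \<open>card_roots_le\<close>
  allows about \<open>sqrt (N / b)\<close> quotients per divisor of \<open>b\<close>. The extra
  \<open>1\<close> is absorbed because \<open>N / b \<ge> 1\<close>.\<close>

lemma card_bounded_roots_le:
  fixes n b :: int and N :: nat and D \<delta> :: real
  assumes "n \<noteq> 0" "1 \<le> b" "b \<le> int N" "\<delta> > 0"
    and D: "D \<ge> 1" "\<And>m. m > 0 \<Longrightarrow> real (card {d. d dvd m}) \<le> D * real m powr \<delta>"
  defines "k \<equiv> real_of_int \<bar>n\<bar>"
  shows "real (card {t. 0 \<le> t \<and> t\<^sup>2 \<le> b * int N + \<bar>n\<bar> \<and> b dvd t\<^sup>2 - n})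
    \<le> D * real N powr \<delta> * ((4 * k * (1 + k) + 1) * sqrt (real N / of_int b))"
proof -
  have b: "1 \<le> real_of_int b" "real_of_int b \<le> real N" using assms by linarith+
  have N: "1 \<le> real N" using b by linarith
  have k: "k \<ge> 0" by (simp add: k_def)
  define L where "L = \<lfloor>sqrt (b * real N + k)\<rfloor>"
  have L0: "0 \<le> L" using b N k by (simp add: L_def)
  have "of_int L \<le> sqrt (b * real N + k)" by (simp add: L_def)
  also have "\<dots> \<le> sqrt ((1 + k)\<^sup>2 * (b * real N))"
  proof (rule real_sqrt_le_mono)
    have "1 * 1 \<le> b * real N" using b N by (intro mult_mono) auto
    then have "k * 1 \<le> k * (b * real N)" using k by (intro mult_left_mono) auto
    then have "b * real N + k \<le> (1 + k) * (b * real N)" by (simp add: algebra_simps)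
    also have "\<dots> \<le> (1 + k)\<^sup>2 * (b * real N)"
      using k b N by (intro mult_right_mono) (auto simp: power2_eq_square algebra_simps)
    finally show "b * real N + k \<le> (1 + k)\<^sup>2 * (b * real N)" .
  qed
  finally have L: "of_int L \<le> (1 + k) * sqrt (b * real N)"
    using k by (simp add: real_sqrt_mult)
  have sq: "sqrt (b * real N) / b = sqrt (real N / b)"
    using b by (simp add: real_sqrt_mult real_sqrt_divide field_simps)
  have "{t. 0 \<le> t \<and> t\<^sup>2 \<le> b * int N + \<bar>n\<bar> \<and> b dvd t\<^sup>2 - n} \<subseteq> {t. 0 \<le> t \<and> t \<le> L \<and> b dvd t\<^sup>2 - n}"
  proof clarify
    fix t assume t: "0 \<le> t" "t\<^sup>2 \<le> b * int N + \<bar>n\<bar>"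
    have "real_of_int (t\<^sup>2) \<le> real_of_int (b * int N + \<bar>n\<bar>)" using t by (simp only: of_int_le_iff)
    then have "sqrt ((real_of_int t)\<^sup>2) \<le> sqrt (b * real N + k)"
      by (intro real_sqrt_le_mono) (simp add: k_def)
    then show "t \<le> L" using t by (simp add: L_def le_floor_iff)
  qed
  moreover have "finite {t. 0 \<le> t \<and> t \<le> L \<and> b dvd t\<^sup>2 - n}"
    by (rule finite_subset[of _ "{0..L}"]) auto
  ultimately have "card {t. 0 \<le> t \<and> t\<^sup>2 \<le> b * int N + \<bar>n\<bar> \<and> b dvd t\<^sup>2 - n}
      \<le> card {t. 0 \<le> t \<and> t \<le> L \<and> b dvd t\<^sup>2 - n}"
    by (rule card_mono[rotated])
  also have "\<dots> \<le> card {d. d dvd nat b} * nat (4 * \<bar>n\<bar> * L div b + 1)"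
    using assms L0 by (intro card_roots_le) auto
  finally have "real (card {t. 0 \<le> t \<and> t\<^sup>2 \<le> b * int N + \<bar>n\<bar> \<and> b dvd t\<^sup>2 - n})
      \<le> real (card {d. d dvd nat b}) * real (nat (4 * \<bar>n\<bar> * L div b + 1))"
    unfolding of_nat_mult[symmetric] of_nat_le_iff .
  also have "\<dots> \<le> (D * real N powr \<delta>) * ((4 * k * (1 + k) + 1) * sqrt (real N / b))"
  proof (rule mult_mono)
    have "real (card {d. d dvd nat b}) \<le> D * real (nat b) powr \<delta>" using assms by (intro D) auto
    also have "\<dots> \<le> D * real N powr \<delta>"
      using D b assms by (intro mult_left_mono powr_mono2) auto
    finally show "real (card {d. d dvd nat b}) \<le> D * real N powr \<delta>" .
    have "0 \<le> 4 * \<bar>n\<bar> * L div b" using L0 assms by (simp add: pos_imp_zdiv_nonneg_iff)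
    then have "real (nat (4 * \<bar>n\<bar> * L div b + 1)) = of_int (4 * \<bar>n\<bar> * L div b) + 1" by simp
    also have "\<dots> \<le> of_int (4 * \<bar>n\<bar> * L) / of_int b + 1"
      by (simp only: add_le_cancel_right real_of_int_div4)
    also have "of_int (4 * \<bar>n\<bar> * L) / of_int b \<le> 4 * k * ((1 + k) * sqrt (b * real N)) / b"
      using L b k by (intro divide_right_mono) (auto simp: k_def mult_left_mono)
    also have "\<dots> = 4 * k * (1 + k) * sqrt (real N / b)"
      unfolding sq[symmetric] by (simp only: times_divide_eq_right mult.assoc)
    finally have "real (nat (4 * \<bar>n\<bar> * L div b + 1)) \<le> 4 * k * (1 + k) * sqrt (real N / b) + 1"
      by simp
    moreover have "1 \<le> sqrt (real N / b)" using b by (intro real_le_rsqrt) simp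
    ultimately show "real (nat (4 * \<bar>n\<bar> * L div b + 1)) \<le> (4 * k * (1 + k) + 1) * sqrt (real N / b)"
      unfolding distrib_right by linarith
  qed (use D in auto)
  finally show ?thesis .
qed

text \<open>Here \<open>r\<close> is at most a multiple of \<open>sqrt N\<close>. Each
  \<open>r\<close> admits \<open>O(N powr \<delta>)\<close> values \<open>b\<close>, being divisors
  of \<open>r^2 - n\<close>, and each \<open>b\<close> admits
  \<open>O(N powr \<delta> * sqrt (N / b))\<close> values \<open>t\<close>. As \<open>b\<close> is
  at least of the order of \<open>r + 1\<close>, summing \<open>1 / sqrt (r + 1)\<close> over
  \<open>r\<close> contributes \<open>N powr (1/4)\<close>. The exponent is
  \<open>1/16 + 1/16 + 1/2 + 1/4 = 7/8\<close>.\<close>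

lemma card_irregular_params_le:
  assumes "n \<noteq> 0"
  obtains C where "C > 0" "\<And>N. N \<ge> 1 \<Longrightarrow> real (card (irregular_params n N)) \<le> C * real N powr (7 / 8)"
proof -
  define \<delta> :: real where "\<delta> = 1 / 16"
  obtain D where D: "D \<ge> 1" "\<And>m. m > 0 \<Longrightarrow> real (card {d. d dvd m}) \<le> D * real m powr \<delta>"
    using divisor_bound[of \<delta>] by (auto simp: \<delta>_def)
  define k where "k = real_of_int \<bar>n\<bar>"
  have k: "k \<ge> 1" using assms by (simp add: k_def)
  define K where "K = (4 * k * (1 + k) + 1) * (2 + k)"
  have K: "K > 0" using k by (simp add: K_def add_pos_pos)
  define C where "C = D * D * K * (5 * k\<^sup>2) * (2 * (2 * k + 1))"
  show thesis
  proof (rule that[of C])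
    show "C > 0" unfolding C_def using D(1) K k by (intro mult_pos_pos) auto
    fix N :: nat assume N1: "N \<ge> 1"
    then have N: "real N \<ge> 1" by simp
    define R where "R = nat \<lfloor>2 * k * sqrt (real N)\<rfloor>"
    have R: "real R \<le> 2 * k * sqrt (real N)" using k by (simp add: R_def)
    define B where "B = (\<lambda>r. {b. r\<^sup>2 \<noteq> n \<and> 1 \<le> b \<and> b \<le> int N \<and> r\<^sup>2 \<le> 4 * n\<^sup>2 * int N \<and>
        r\<^sup>2 \<le> (1 + \<bar>n\<bar>) * b\<^sup>2 \<and> b dvd r\<^sup>2 - n})"
    define T where "T = (\<lambda>b. {t. 0 \<le> t \<and> t\<^sup>2 \<le> b * int N + \<bar>n\<bar> \<and> b dvd t\<^sup>2 - n})"
    have finB: "finite (B r)" for r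
      by (rule finite_subset[of _ "{1..int N}"]) (auto simp: B_def)
    have finT: "finite (T b)" for b
    proof (rule finite_subset)
      show "T b \<subseteq> {0..b * int N + \<bar>n\<bar>}"
      proof
        fix t assume "t \<in> T b"
        then have t: "0 \<le> t" "t\<^sup>2 \<le> b * int N + \<bar>n\<bar>" by (auto simp: T_def)
        have "t \<le> t\<^sup>2" using t self_le_power[of t 2] by (cases "t = 0") auto
        with t show "t \<in> {0..b * int N + \<bar>n\<bar>}" by simp
      qed
    qed simp
    have sub: "irregular_params n N \<subseteq> (SIGMA r:{0..int R}. SIGMA b:B r. T b)"
    proof
      fix p assume p: "p \<in> irregular_params n N"
      obtain r b t where pp: "p = (r, b, t)" using prod_cases3 by blast
      note * = p[unfolded pp]
      then have r: "0 \<le> r" "r\<^sup>2 \<le> 4 * n\<^sup>2 * int N" by (auto simp: irregular_params_def)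
      have "real_of_int (r\<^sup>2) \<le> real_of_int (4 * n\<^sup>2 * int N)" using r by (simp only: of_int_le_iff)
      also have "\<dots> = (2 * k * sqrt (real N))\<^sup>2" by (simp add: k_def power_mult_distrib)
      finally have "(real_of_int r)\<^sup>2 \<le> (2 * k * sqrt (real N))\<^sup>2" by (simp only: of_int_power)
      then have "real_of_int r \<le> 2 * k * sqrt (real N)"
        by (rule power2_le_imp_le) (use k in simp)
      then have "r \<le> int R" using k r by (simp add: R_def le_floor_iff)
      with * show "p \<in> (SIGMA r:{0..int R}. SIGMA b:B r. T b)"
        by (auto simp: pp irregular_params_def B_def T_def)
    qed
    have cardB: "real (card (B r)) \<le> D * (5 * k\<^sup>2) * real N powr \<delta>" for r
    proof (cases "B r = {}")
      case True
      then show ?thesis using D k by simp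
    next
      case False
      then have r: "r\<^sup>2 \<noteq> n" "r\<^sup>2 \<le> 4 * n\<^sup>2 * int N" by (auto simp: B_def)
      define m where "m = nat \<bar>r\<^sup>2 - n\<bar>"
      have m0: "m > 0" using r by (simp add: m_def)
      have "nat ` B r \<subseteq> {d. d dvd m}"
      proof clarify
        fix b assume b: "b \<in> B r"
        then have "int (nat b) dvd int m" by (auto simp: B_def m_def)
        then show "nat b dvd m" by (simp only: of_nat_dvd_iff)
      qed
      moreover have "inj_on nat (B r)" by (auto simp: inj_on_def B_def)
      ultimately have "card (B r) \<le> card {d. d dvd m}"
        using m0 by (intro card_inj_on_le[of nat]) auto
      then have "real (card (B r)) \<le> D * real m powr \<delta>" using D(2)[OF m0] by linarith
      also have "\<dots> \<le> D * ((5 * k\<^sup>2) * real N) powr \<delta>"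
      proof (intro mult_left_mono powr_mono2)
        have "real m = \<bar>real_of_int (r\<^sup>2) - real_of_int n\<bar>" by (simp add: m_def)
        also have "\<dots> \<le> \<bar>real_of_int (r\<^sup>2)\<bar> + k" by (simp only: k_def of_int_abs abs_triangle_ineq4)
        also have "\<bar>real_of_int (r\<^sup>2)\<bar> = real_of_int (r\<^sup>2)" by simp
        also have "real_of_int (r\<^sup>2) \<le> real_of_int (4 * n\<^sup>2 * int N)" using r by (simp only: of_int_le_iff)
        also have "\<dots> = 4 * k\<^sup>2 * real N" by (simp add: k_def)
        finally have "real m \<le> 4 * k\<^sup>2 * real N + k" by simp
        moreover have "k * 1 \<le> k\<^sup>2 * real N"
          using k N by (intro mult_mono) (auto simp: power2_eq_square)
        ultimately show "real m \<le> 5 * k\<^sup>2 * real N" by simp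
      qed (use D in \<open>auto simp: \<delta>_def\<close>)
      also have "\<dots> = D * ((5 * k\<^sup>2) powr \<delta> * real N powr \<delta>)" by (simp add: powr_mult)
      also have "(5 * k\<^sup>2) powr \<delta> \<le> 5 * k\<^sup>2"
      proof -
        have "1 \<le> k\<^sup>2" using k by simp
        then show ?thesis using powr_mono[of \<delta> 1 "5 * k\<^sup>2"] by (simp add: \<delta>_def)
      qed
      finally have "real (card (B r)) \<le> D * ((5 * k\<^sup>2) * real N powr \<delta>)"
        using D(1) by (simp add: mult_left_mono mult_right_mono)
      then show ?thesis by (simp only: mult.assoc)
    qed
    have cardT: "real (card (T b)) \<le> D * K * real N powr \<delta> * sqrt (real N) * (1 / sqrt (of_int r + 1))"
      if "0 \<le> r" "b \<in> B r" for r b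
    proof -
      have b: "1 \<le> b" "b \<le> int N" "r\<^sup>2 \<le> (1 + \<bar>n\<bar>) * b\<^sup>2" using that by (auto simp: B_def)
      have b1: "1 \<le> real_of_int b" using b by simp
      \<comment> \<open>Enlarging the factor to its square allows the square root to be taken within
        the integers.\<close>
      have "(1 + \<bar>n\<bar>) * b\<^sup>2 \<le> (1 + \<bar>n\<bar>) * ((1 + \<bar>n\<bar>) * b\<^sup>2)"
        by (intro mult_left_mono) (auto simp: distrib_right)
      also have "(1 + \<bar>n\<bar>) * ((1 + \<bar>n\<bar>) * b\<^sup>2) = ((1 + \<bar>n\<bar>) * b)\<^sup>2"
        by (simp only: power2_eq_square mult_ac)
      finally have "r\<^sup>2 \<le> ((1 + \<bar>n\<bar>) * b)\<^sup>2" using b by linarith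
      then have "r \<le> (1 + \<bar>n\<bar>) * b" using b by (intro power2_le_imp_le[of r]) auto
      then have "r + 1 \<le> (2 + \<bar>n\<bar>) * b" using b by (simp add: algebra_simps)
      then have "real_of_int (r + 1) \<le> real_of_int ((2 + \<bar>n\<bar>) * b)" by (simp only: of_int_le_iff)
      then have rb: "real_of_int r + 1 \<le> (2 + k) * b" by (simp add: k_def)
      have "real N / b \<le> (2 + k)\<^sup>2 * (real N / (of_int r + 1))"
      proof -
        have "real N / b = (2 + k) * real N / ((2 + k) * b)" using k by simp
        also have "\<dots> \<le> (2 + k) * real N / (of_int r + 1)"
          using rb k that b1 by (intro divide_left_mono) auto
        also have "\<dots> \<le> (2 + k)\<^sup>2 * real N / (of_int r + 1)"
          using k that by (intro divide_right_mono mult_right_mono) (auto simp: power2_eq_square)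
        finally show ?thesis by simp
      qed
      then have "sqrt (real N / b) \<le> sqrt ((2 + k)\<^sup>2 * (real N / (of_int r + 1)))"
        by (rule real_sqrt_le_mono)
      also have "\<dots> = (2 + k) * sqrt (real N) * (1 / sqrt (of_int r + 1))"
        using k by (simp add: real_sqrt_mult real_sqrt_divide)
      finally have sq: "sqrt (real N / b) \<le> (2 + k) * sqrt (real N) * (1 / sqrt (of_int r + 1))" .
      have "real (card (T b)) \<le> D * real N powr \<delta> * ((4 * k * (1 + k) + 1) * sqrt (real N / b))"
        unfolding T_def k_def using assms b D by (intro card_bounded_roots_le) (auto simp: \<delta>_def)
      also have "\<dots> \<le> D * real N powr \<delta> * ((4 * k * (1 + k) + 1) *
          ((2 + k) * sqrt (real N) * (1 / sqrt (of_int r + 1))))"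
        using sq D k by (intro mult_left_mono) auto
      finally show ?thesis by (simp add: K_def mult_ac)
    qed
    have "card (irregular_params n N) \<le> card (SIGMA r:{0..int R}. SIGMA b:B r. T b)"
      using sub finB finT by (intro card_mono) (auto intro!: finite_SigmaI)
    also have "\<dots> = (\<Sum>r\<in>{0..int R}. \<Sum>b\<in>B r. card (T b))"
      using finB finT by (simp add: card_SigmaI)
    finally have "real (card (irregular_params n N)) \<le> (\<Sum>r\<in>{0..int R}. \<Sum>b\<in>B r. real (card (T b)))"
      unfolding of_nat_sum[symmetric] of_nat_le_iff .
    also have "\<dots> \<le> (\<Sum>r\<in>{0..int R}. \<Sum>b\<in>B r. D * K * real N powr \<delta> * sqrt (real N) * (1 / sqrt (of_int r + 1)))"
      using cardT by (intro sum_mono) auto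
    also have "\<dots> = (\<Sum>r\<in>{0..int R}. real (card (B r)) *
        (D * K * real N powr \<delta> * sqrt (real N) * (1 / sqrt (of_int r + 1))))"
      by simp
    also have "\<dots> \<le> (\<Sum>r\<in>{0..int R}. (D * (5 * k\<^sup>2) * real N powr \<delta>) *
        (D * K * real N powr \<delta> * sqrt (real N) * (1 / sqrt (of_int r + 1))))"
      using cardB D K by (intro sum_mono mult_right_mono) auto
    also have "\<dots> = (D * (5 * k\<^sup>2) * real N powr \<delta>) * (D * K * real N powr \<delta> * sqrt (real N)) *
        (\<Sum>r\<in>{0..int R}. 1 / sqrt (of_int r + 1))"
      by (simp add: sum_distrib_left mult_ac)
    also have "\<dots> \<le> (D * (5 * k\<^sup>2) * real N powr \<delta>) * (D * K * real N powr \<delta> * sqrt (real N)) *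
        (2 * ((2 * k + 1) * real N powr (1 / 4)))"
    proof (intro mult_left_mono)
      have "sqrt (real R + 1) \<le> sqrt ((2 * k + 1)\<^sup>2 * sqrt (real N))"
      proof (rule real_sqrt_le_mono)
        have "1 \<le> sqrt (real N)" using N by (intro real_le_rsqrt) simp
        then have "real R + 1 \<le> (2 * k + 1) * sqrt (real N)" using R unfolding distrib_right by linarith
        also have "\<dots> \<le> (2 * k + 1)\<^sup>2 * sqrt (real N)"
          using k by (intro mult_right_mono) (auto simp: power2_eq_square)
        finally show "real R + 1 \<le> (2 * k + 1)\<^sup>2 * sqrt (real N)" .
      qed
      also have "\<dots> = (2 * k + 1) * sqrt (sqrt (real N))"
        using k by (simp add: real_sqrt_mult)
      also have "sqrt (sqrt (real N)) = real N powr (1 / 4)"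
        using N by (simp add: powr_half_sqrt[symmetric] powr_powr)
      finally show "(\<Sum>r\<in>{0..int R}. 1 / sqrt (of_int r + 1)) \<le> 2 * ((2 * k + 1) * real N powr (1 / 4))"
        using sum_int_inverse_sqrt_le[of R] by linarith
    qed (use D K in auto)
    also have "\<dots> = C * (real N powr \<delta> * real N powr \<delta> * real N powr (1 / 2) * real N powr (1 / 4))"
      using N by (simp add: C_def powr_half_sqrt mult_ac)
    also have "real N powr \<delta> * real N powr \<delta> * real N powr (1 / 2) * real N powr (1 / 4) = real N powr (7 / 8)"
      by (simp add: \<delta>_def flip: powr_add)
    finally show "real (card (irregular_params n N)) \<le> C * real N powr (7 / 8)" .
  qed
qed

section \<open>Boundary roots\<close>

text \<open>An outer root lies within \<open>\<bar>n\<bar> + 1\<close> of \<open>0\<close> or of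
  \<open>c\<close>; in the second case its reflection is the small root \<open>j\<close>.\<close>

lemma outer_pairs_subset:
  "root_pairs n N - inner_pairs n N \<subseteq>
    {(c, r). 1 \<le> c \<and> c \<le> int N \<and> (\<exists>j\<in>{0..\<bar>n\<bar> + 1}. c dvd j\<^sup>2 - n \<and> (r = j \<or> r = c - j))}"
proof clarify
  fix c r assume p: "(c, r) \<in> root_pairs n N" "(c, r) \<notin> inner_pairs n N"
  then have c: "1 \<le> c" "c \<le> int N" "0 \<le> r" "r < c" "c dvd r\<^sup>2 - n"
    and "r \<le> \<bar>n\<bar> + 1 \<or> c \<le> r + (\<bar>n\<bar> + 1)"
    by (auto simp: root_pairs_def inner_pairs_def)
  have "(c - r)\<^sup>2 - n = c * (c - 2 * r) + (r\<^sup>2 - n)"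
    by (simp add: power2_eq_square algebra_simps)
  then have c': "c dvd (c - r)\<^sup>2 - n" using c by (simp only: dvd_add dvd_triv_left)
  from \<open>r \<le> \<bar>n\<bar> + 1 \<or> c \<le> r + (\<bar>n\<bar> + 1)\<close>
  have "\<exists>j\<in>{0..\<bar>n\<bar> + 1}. c dvd j\<^sup>2 - n \<and> (r = j \<or> r = c - j)"
  proof
    assume "r \<le> \<bar>n\<bar> + 1"
    then show ?thesis using c by (intro bexI[of _ r]) auto
  next
    assume "c \<le> r + (\<bar>n\<bar> + 1)"
    then show ?thesis using c c' by (intro bexI[of _ "c - r"]) auto
  qed
  with c show "1 \<le> c \<and> c \<le> int N \<and> (\<exists>j\<in>{0..\<bar>n\<bar> + 1}. c dvd j\<^sup>2 - n \<and> (r = j \<or> r = c - j))"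
    by blast
qed

text \<open>Linear growth really occurs for \<open>n = k^2\<close>: every \<open>c\<close> divides
  \<open>j^2 - n\<close> for \<open>j = k\<close>.\<close>

lemma card_outer_pairs_le:
  "card (root_pairs n N - inner_pairs n N) \<le> 2 * nat (\<bar>n\<bar> + 2) * N"
proof -
  let ?S = "{1..int N} \<times> {0..\<bar>n\<bar> + 1}"
  have "root_pairs n N - inner_pairs n N \<subseteq> ?S \<union> (\<lambda>(c, j). (c, c - j)) ` ?S"
    using outer_pairs_subset[of n N] by (fastforce simp: image_iff)
  then have "card (root_pairs n N - inner_pairs n N) \<le> card (?S \<union> (\<lambda>(c, j). (c, c - j)) ` ?S)"
    by (intro card_mono) auto
  also have "\<dots> \<le> card ?S + card ((\<lambda>(c, j). (c, c - j)) ` ?S)" by (rule card_Un_le)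
  also have "\<dots> \<le> card ?S + card ?S" by (intro add_left_mono card_image_le) auto
  also have "\<dots> = 2 * nat (\<bar>n\<bar> + 2) * N"
    by (simp add: card_cartesian_product add.commute[of _ 2])
  finally show ?thesis .
qed

text \<open>If \<open>n\<close> is not a square, then every modulus \<open>c\<close> of an outer pair divides one of the
  finitely many non-zero numbers \<open>j\<^sup>2 - n\<close>.\<close>

lemma card_outer_pairs_bounded:
  assumes "\<not> is_square n"
  obtains K where "\<And>N. card (root_pairs n N - inner_pairs n N) \<le> K"
proof
  fix N
  define M where "M = (\<bar>n\<bar> + 1)\<^sup>2 + \<bar>n\<bar>"
  have "root_pairs n N - inner_pairs n N \<subseteq> {0..M} \<times> {0..M}"
  proof
    fix p assume p: "p \<in> root_pairs n N - inner_pairs n N"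
    obtain c r where pp: "p = (c, r)" by fastforce
    from p obtain j where j: "0 \<le> j" "j \<le> \<bar>n\<bar> + 1" "c dvd j\<^sup>2 - n"
      using outer_pairs_subset[of n N] unfolding pp by fastforce
    have c: "1 \<le> c" "0 \<le> r" "r < c" using p by (auto simp: pp root_pairs_def)
    have "j\<^sup>2 - n \<noteq> 0" using assms by (auto simp: is_nth_power_def)
    then have "\<bar>c\<bar> \<le> \<bar>j\<^sup>2 - n\<bar>" using j(3) dvd_imp_le_int by blast
    moreover have "j\<^sup>2 \<le> (\<bar>n\<bar> + 1)\<^sup>2" using j by (intro power_mono) auto
    moreover have "0 \<le> j\<^sup>2" by simp
    ultimately have "c \<le> M" unfolding M_def by linarith
    with c show "p \<in> {0..M} \<times> {0..M}" by (simp add: pp)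
  qed
  then show "card (root_pairs n N - inner_pairs n N) \<le> card ({0..M} \<times> {0..M})"
    by (rule card_mono[rotated]) simp
qed

lemma card_root_pairs_eq:
  "card (root_pairs n N) = card (inner_pairs n N) + card (root_pairs n N - inner_pairs n N)"
proof -
  have "inner_pairs n N \<subseteq> root_pairs n N" by (auto simp: inner_pairs_def)
  then show ?thesis
    by (metis card_Un_disjoint Diff_disjoint Un_Diff_cancel finite_Diff finite_inner_pairs
        finite_root_pairs sup.absorb2)
qed

section \<open>Lower bound from a binary quadratic form\<close>

text \<open>If \<open>c = x\<^sup>2 - n y\<^sup>2\<close> with \<open>x\<close>, \<open>y\<close> coprime, then \<open>x / y\<close> is a square root of \<open>n\<close> modulo \<open>c\<close>;
  in a box of suitable shape this root determines \<open>(x, y)\<close>.\<close>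

lemma root_of_proper_representation:
  fixes c x y n :: int
  assumes "c = x\<^sup>2 - n * y\<^sup>2" "coprime x y" "0 < c"
  obtains r where "0 \<le> r" "r < c" "c dvd r * y - x" "c dvd r\<^sup>2 - n"
proof -
  have "coprime y c"
  proof (rule coprimeI)
    fix d assume d: "d dvd y" "d dvd c"
    then have "d dvd c + n * y\<^sup>2" by (simp add: power2_eq_square)
    then have "d dvd x\<^sup>2" by (simp add: assms(1))
    moreover have "coprime (x\<^sup>2) y" using assms(2) by simp
    ultimately show "is_unit d" using d(1) by (metis coprime_common_divisor)
  qed
  then obtain u where u: "[y * u = 1] (mod c)" using cong_solve_coprime_int by blast
  define r where "r = (x * u) mod c"
  have "[r = x * u] (mod c)" by (simp add: r_def cong_def)
  then have "[r * y = x * u * y] (mod c)" by (rule cong_mult) simp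
  also have "[x * u * y = x * (y * u)] (mod c)" by (simp add: mult_ac)
  also have "[x * (y * u) = x * 1] (mod c)" using u by (intro cong_mult) auto
  finally have ry: "c dvd r * y - x" by (simp add: cong_iff_dvd_diff)
  \<comment> \<open>This product is \<open>y^2 * (r^2 - n)\<close> up to a multiple of
    \<open>c\<close>, and \<open>y\<close> is a unit modulo \<open>c\<close>.\<close>
  then have "c dvd (r * y - x) * (r * y + x)" by simp
  moreover have "(r * y - x) * (r * y + x) = y\<^sup>2 * (r\<^sup>2 - n) - c"
    by (simp add: assms(1) power2_eq_square algebra_simps)
  ultimately have "c dvd (y\<^sup>2 * (r\<^sup>2 - n) - c) + c" by (metis dvd_add dvd_refl)
  then have "c dvd y\<^sup>2 * (r\<^sup>2 - n)" by simp
  moreover have "coprime c (y\<^sup>2)" using \<open>coprime y c\<close> by (simp add: coprime_commute)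
  ultimately have "c dvd r\<^sup>2 - n" using coprime_dvd_mult_right_iff by blast
  with ry that[of r] assms(3) show thesis by (simp add: r_def)
qed

text \<open>The bound on \<open>y\<close> serves two purposes: \<open>n * y^2\<close> is at most a
  quarter of \<open>X^2\<close> in absolute value, so the form takes values above
  \<open>X^2 / 2\<close>; and for \<open>n \<noteq> 0\<close> cross products \<open>x * y'\<close>
  of two box points are at most \<open>X^2 / 2\<close>, hence below the modulus.\<close>

definition form_box :: "int \<Rightarrow> nat \<Rightarrow> (nat \<times> nat) set" where
  "form_box n X = {(y, x). 1 \<le> y \<and> (nat \<bar>n\<bar> + 3) * y \<le> X \<and> X < x \<and> x \<le> 2 * X \<and> coprime x y}"

lemma finite_form_box [simp]: "finite (form_box n X)"
proof (rule finite_subset)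
  show "form_box n X \<subseteq> {..X} \<times> {..2 * X}" by (auto simp: form_box_def add_mult_distrib)
qed simp

lemma form_box_value:
  assumes "(y, x) \<in> form_box n X"
  shows "(int X)\<^sup>2 < 2 * ((int x)\<^sup>2 - n * (int y)\<^sup>2)" "(int x)\<^sup>2 - n * (int y)\<^sup>2 \<le> 5 * (int X)\<^sup>2"
proof -
  have "int ((nat \<bar>n\<bar> + 3) * y) \<le> int X" using assms by (auto simp: form_box_def simp del: of_nat_mult)
  then have "((\<bar>n\<bar> + 3) * int y)\<^sup>2 \<le> (int X)\<^sup>2" by (intro power_mono) auto
  moreover have "4 * \<bar>n\<bar> \<le> (\<bar>n\<bar> + 3)\<^sup>2" by (simp add: power2_eq_square algebra_simps)
  then have "4 * \<bar>n\<bar> * (int y)\<^sup>2 \<le> (\<bar>n\<bar> + 3)\<^sup>2 * (int y)\<^sup>2" by (rule mult_right_mono) simp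
  ultimately have "4 * \<bar>n\<bar> * (int y)\<^sup>2 \<le> (int X)\<^sup>2" by (simp add: power_mult_distrib)
  moreover have "\<bar>n * (int y)\<^sup>2\<bar> = \<bar>n\<bar> * (int y)\<^sup>2" by (simp add: abs_mult)
  ultimately have "\<bar>4 * (n * (int y)\<^sup>2)\<bar> \<le> (int X)\<^sup>2" by (simp add: abs_mult)
  then have y: "4 * (n * (int y)\<^sup>2) \<le> (int X)\<^sup>2" "- (4 * (n * (int y)\<^sup>2)) \<le> (int X)\<^sup>2"
    by (simp_all only: abs_le_iff)
  have "(int X)\<^sup>2 < (int x)\<^sup>2" using assms by (intro power_strict_mono) (auto simp: form_box_def)
  moreover have "(int x)\<^sup>2 \<le> (2 * int X)\<^sup>2" using assms by (intro power_mono) (auto simp: form_box_def)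
  then have "(int x)\<^sup>2 \<le> 4 * (int X)\<^sup>2" by (simp add: power_mult_distrib)
  moreover have "0 \<le> (int X)\<^sup>2" by simp
  ultimately show "(int X)\<^sup>2 < 2 * ((int x)\<^sup>2 - n * (int y)\<^sup>2)" "(int x)\<^sup>2 - n * (int y)\<^sup>2 \<le> 5 * (int X)\<^sup>2"
    using y unfolding right_diff_distrib by linarith+
qed

lemma form_box_cross_le:
  assumes "n \<noteq> 0" "(y, x) \<in> form_box n X" "(y', x') \<in> form_box n X"
  shows "2 * (int x * int y') \<le> (int X)\<^sup>2"
proof -
  have "4 * y' \<le> (nat \<bar>n\<bar> + 3) * y'" using assms(1) by (intro mult_right_mono) auto
  also have "\<dots> \<le> X" using assms by (auto simp: form_box_def)
  finally have "4 * y' \<le> X" .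
  moreover have "x \<le> 2 * X" using assms by (auto simp: form_box_def)
  ultimately have "x * (4 * y') \<le> (2 * X) * X" by (intro mult_mono) auto
  then have "2 * (x * y') \<le> X\<^sup>2" by (simp add: power2_eq_square)
  then have "int (2 * (x * y')) \<le> int (X\<^sup>2)" by (simp only: of_nat_le_iff)
  then show ?thesis by simp
qed

text \<open>If two points give the same modulus \<open>c\<close> and root, then \<open>c\<close>
  divides \<open>x' y - x y'\<close>. Both products are positive and smaller than \<open>c\<close>,
  so the difference vanishes and coprimality makes the points equal.\<close>

lemma card_form_box_le:
  assumes "n \<noteq> 0" "5 * X\<^sup>2 \<le> N"
  shows "card (form_box n X) \<le> card (root_pairs n N)"
proof -
  define v where "v = (\<lambda>(y, x). (int x)\<^sup>2 - n * (int y)\<^sup>2)"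
  have "\<exists>r. 0 \<le> r \<and> r < v p \<and> v p dvd r * int (fst p) - int (snd p) \<and> v p dvd r\<^sup>2 - n"
    if p: "p \<in> form_box n X" for p
  proof -
    obtain y x where pp: "p = (y, x)" by fastforce
    have "0 < 2 * v p" unfolding pp v_def prod.case
      by (rule order.strict_trans1[OF zero_le_power2 form_box_value(1)[OF p[unfolded pp]]])
    then have "0 < v p" by simp
    moreover have "coprime (int x) (int y)" using p by (auto simp: pp form_box_def)
    ultimately show ?thesis
      using root_of_proper_representation[of "v p" "int x" n "int y"] by (auto simp: pp v_def)
  qed
  then obtain \<rho> where \<rho>: "0 \<le> \<rho> p" "\<rho> p < v p" "v p dvd \<rho> p * int (fst p) - int (snd p)"
    "v p dvd (\<rho> p)\<^sup>2 - n" if "p \<in> form_box n X" for p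
    by metis
  have "inj_on (\<lambda>p. (v p, \<rho> p)) (form_box n X)"
  proof (rule inj_onI)
    fix p p' assume p: "p \<in> form_box n X" "p' \<in> form_box n X" "(v p, \<rho> p) = (v p', \<rho> p')"
    obtain y x y' x' where pp: "p = (y, x)" "p' = (y', x')" by fastforce
    define c r where "c = v p" and "r = \<rho> p"
    have "c dvd r * int y - int x" "c dvd r * int y' - int x'"
      using \<rho>(3)[OF p(1)] \<rho>(3)[OF p(2)] p(3) by (simp_all add: c_def r_def pp)
    then have "c dvd (r * int y - int x) * int y' - (r * int y' - int x') * int y"
      by (intro dvd_diff) auto
    then have dvd: "c dvd int x' * int y - int x * int y'" by (simp add: algebra_simps)
    have pos: "0 < x" "0 < y" "0 < x'" "0 < y'" using p by (auto simp: pp form_box_def)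
    then have pos2: "0 < int x' * int y" "0 < int x * int y'" by auto
    have "(int X)\<^sup>2 < 2 * c" using form_box_value(1) p(1) by (simp add: c_def v_def pp)
    moreover have "2 * (int x * int y') \<le> (int X)\<^sup>2" "2 * (int x' * int y) \<le> (int X)\<^sup>2"
      using form_box_cross_le[OF assms(1)] p by (auto simp: pp)
    ultimately have "\<bar>int x' * int y - int x * int y'\<bar> < \<bar>c\<bar>" using pos2 by linarith
    then have "int x' * int y - int x * int y' = 0" using dvd_imp_le_int[OF _ dvd] by linarith
    then have eq: "x' * y = x * y'" by (simp flip: of_nat_mult)
    have co: "coprime x y" "coprime x' y'" using p by (auto simp: pp form_box_def)
    have "x dvd x'" using eq co(1) by (metis coprime_dvd_mult_left_iff dvd_triv_left)
    moreover have "x' dvd x" using eq co(2) by (metis coprime_dvd_mult_left_iff dvd_triv_left)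
    ultimately have "x = x'" by (rule dvd_antisym)
    with eq pos show "p = p'" by (simp add: pp)
  qed
  moreover have "(\<lambda>p. (v p, \<rho> p)) ` form_box n X \<subseteq> root_pairs n N"
  proof (rule image_subsetI)
    fix p assume p: "p \<in> form_box n X"
    obtain y x where pp: "p = (y, x)" by fastforce
    have "v p \<le> int (5 * X\<^sup>2)" using form_box_value(2) p by (simp add: v_def pp)
    also have "\<dots> \<le> int N" using assms(2) by (simp only: of_nat_le_iff)
    finally show "(v p, \<rho> p) \<in> root_pairs n N"
      using \<rho>[OF p] by (simp add: root_pairs_def)
  qed
  ultimately show ?thesis by (intro card_inj_on_le) auto
qed

text \<open>For each admissible \<open>y\<close> the interval from \<open>X\<close> to
  \<open>2 X\<close> holds at least \<open>X / (2 y)\<close> full periods modulo \<open>y\<close>,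
  each with \<open>totient y \<ge> y / (D * X powr \<delta>)\<close> coprime residues. The
  \<open>y\<close> cancels, so all columns obey the same bound.\<close>

lemma card_form_box_ge:
  assumes D: "D \<ge> 1" "\<And>m. m > 0 \<Longrightarrow> real (card {d. d dvd m}) \<le> D * real m powr \<delta>"
    and "\<delta> > 0" "n \<noteq> 0"
  shows "real (X div (nat \<bar>n\<bar> + 3)) * real X / (2 * D * real X powr \<delta>) \<le> real (card (form_box n X))"
proof (cases "X = 0")
  case False
  define K where "K = nat \<bar>n\<bar> + 3"
  have K: "K \<ge> 4" using assms by (simp add: K_def)
  define Y where "Y = X div K"
  define Z where "Z = (\<lambda>y. {x. X < x \<and> x \<le> 2 * X \<and> coprime x y})"
  have finZ: "finite (Z y)" for y by (rule finite_subset[of _ "{..2 * X}"]) (auto simp: Z_def)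
  have Ky: "K * y \<le> X" if "y \<le> Y" for y
    using that by (simp add: Y_def less_eq_div_iff_mult_less_eq K_def mult.commute)
  have summand: "real X / (2 * D * real X powr \<delta>) \<le> real (card (Z y))" if y: "1 \<le> y" "y \<le> Y" for y
  proof -
    have "4 * y \<le> K * y" using K by (rule mult_right_mono) simp
    then have y4: "4 * y \<le> X" using Ky[OF y(2)] by linarith
    \<comment> \<open>Periods start at the first multiple of \<open>y\<close> above
      \<open>X\<close>, namely \<open>y * (X div y + 1)\<close>, and end at
      \<open>2 * y * (X div y) \<le> 2 * X\<close>. Aligning the start costs one period; rounding
      costs less than one more, harmless since \<open>X / y \<ge> 4\<close>.\<close>
    define q where "q = X div y - 1"
    have X4: "4 \<le> X div y" using y4 y by (simp add: less_eq_div_iff_mult_less_eq)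
    have "y * (X div y + 1 + q) = 2 * (y * (X div y))" using X4 by (simp add: q_def algebra_simps)
    also have "\<dots> \<le> 2 * X" by simp
    finally have up: "y * (X div y + 1 + q) \<le> 2 * X" .
    have low: "X < y * (X div y + 1)"
      using y dividend_less_times_div[of y X] by (simp add: algebra_simps)
    have "q * totient y \<le> card {x. y * (X div y + 1) < x \<and> x \<le> y * (X div y + 1 + q) \<and> coprime x y}"
      using y by (intro card_coprime_interval_ge) simp
    also have "\<dots> \<le> card (Z y)"
      using up low finZ[of y] by (intro card_mono) (auto simp: Z_def)
    finally have 1: "real q * real (totient y) \<le> real (card (Z y))"
      by (simp flip: of_nat_mult)
    have "real X / real y - 1 \<le> real (X div y)" using real_div_le_nat_div[of y X] y by simp
    moreover have "real q = real (X div y) - 1" using X4 by (simp add: q_def of_nat_diff)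
    moreover have "4 \<le> real X / real y"
    proof -
      have "real (4 * y) \<le> real X" using y4 by (simp only: of_nat_le_iff)
      then show ?thesis using y by (simp add: field_simps)
    qed
    ultimately have q: "real X / (2 * real y) \<le> real q" by (simp add: field_simps)
    have "real y \<le> real (totient y * card {d. d dvd y})"
      using totient_ge_div_card_divisors[of y] y by (simp only: of_nat_le_iff)
    also have "\<dots> \<le> real (totient y) * (D * real y powr \<delta>)"
      using D(2)[of y] y by (simp add: mult_left_mono)
    also have "\<dots> \<le> real (totient y) * (D * real X powr \<delta>)"
      using D(1) assms(3) y4 by (intro mult_left_mono powr_mono2) auto
    finally have t: "real y / (D * real X powr \<delta>) \<le> real (totient y)"
      using D(1) False by (simp add: field_simps)
    have "real X / (2 * D * real X powr \<delta>) = real X / (2 * real y) * (real y / (D * real X powr \<delta>))"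
      using y by simp
    also have "\<dots> \<le> real q * real (totient y)"
      using q t D(1) by (intro mult_mono) auto
    finally show ?thesis using 1 by linarith
  qed
  have "real Y * (real X / (2 * D * real X powr \<delta>)) = (\<Sum>y=1..Y. real X / (2 * D * real X powr \<delta>))"
    by simp
  also have "\<dots> \<le> (\<Sum>y=1..Y. real (card (Z y)))" using summand by (intro sum_mono) auto
  also have "\<dots> = real (card (SIGMA y:{1..Y}. Z y))" using finZ by (simp add: card_SigmaI)
  also have "\<dots> \<le> real (card (form_box n X))"
    unfolding of_nat_le_iff using Ky
    by (intro card_mono finite_form_box) (auto simp: form_box_def Z_def K_def)
  finally show ?thesis by (simp add: Y_def K_def)
qed simp

text \<open>With \<open>X\<close> about \<open>sqrt (N / 5)\<close> the box contains at least a
  constant times \<open>X powr (2 - \<delta>)\<close> points, and \<open>X powr (31/16)\<close> is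
  of order \<open>N powr (31/32)\<close>.\<close>

lemma card_root_pairs_ge:
  assumes "n \<noteq> 0"
  obtains C where "C > 0" "eventually (\<lambda>N. C * real N powr (31 / 32) \<le> real (card (root_pairs n N))) sequentially"
proof -
  define \<delta> :: real where "\<delta> = 1 / 16"
  obtain D where D: "D \<ge> 1" "\<And>m. m > 0 \<Longrightarrow> real (card {d. d dvd m}) \<le> D * real m powr \<delta>"
    using divisor_bound[of \<delta>] by (auto simp: \<delta>_def)
  define K where "K = nat \<bar>n\<bar> + 3"
  have K: "real K \<ge> 4" using assms by (simp add: K_def)
  define C where "C = (1 / 3) powr (31 / 16) / (4 * real K * D)"
  have "filterlim (\<lambda>N. sqrt (real N)) at_top sequentially" by real_asymp
  \<comment> \<open>The \<open>15\<close> makes up for rounding in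
    \<open>2/5 * sqrt N - 1 \<ge> sqrt N / 3\<close>, and \<open>6 * K\<close> turns this into
    \<open>X \<ge> 2 * K\<close>.\<close>
  then have ev: "eventually (\<lambda>N. sqrt (real N) \<ge> 15 + 6 * real K) sequentially"
    unfolding filterlim_at_top by blast
  show thesis
  proof (rule that[of C])
    show "C > 0" using D(1) K by (simp add: C_def)
    show "eventually (\<lambda>N. C * real N powr (31 / 32) \<le> real (card (root_pairs n N))) sequentially"
      using ev
    proof eventually_elim
      case (elim N)
      define X where "X = nat \<lfloor>sqrt (real N / 5)\<rfloor>"
      have "real X \<le> sqrt (real N / 5)" by (simp add: X_def)
      then have "(real X)\<^sup>2 \<le> (sqrt (real N / 5))\<^sup>2" by (intro power_mono) auto
      then have "real (5 * X\<^sup>2) \<le> real N" by simp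
      then have XN: "5 * X\<^sup>2 \<le> N" by (simp only: of_nat_le_iff)
      have X: "sqrt (real N) / 3 \<le> real X" "2 * real K \<le> real X"
      proof -
        have "(2 / 5 * sqrt (real N))\<^sup>2 \<le> real N / 5" by (simp add: power_mult_distrib power2_eq_square)
        then have "2 / 5 * sqrt (real N) \<le> sqrt (real N / 5)" by (rule real_le_rsqrt)
        moreover have "sqrt (real N / 5) - 1 \<le> real X" unfolding X_def by linarith
        ultimately show "sqrt (real N) / 3 \<le> real X" "2 * real K \<le> real X" using elim by linarith+
      qed
      have X0: "0 < real X" using X K by linarith
      have "real X / real K - 1 \<le> real (X div K)" using real_div_le_nat_div[of K X] K by simp
      moreover have "1 \<le> real X / (2 * real K)" using X K by simp
      ultimately have Y: "real X / (2 * real K) \<le> real (X div K)" by simp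
      have "(sqrt (real N) / 3) powr (31 / 16) = (1 / 3) powr (31 / 16) * (real N powr (1 / 2)) powr (31 / 16)"
        by (simp add: powr_half_sqrt flip: powr_mult)
      also have "\<dots> = (1 / 3) powr (31 / 16) * real N powr (31 / 32)" by (simp add: powr_powr)
      finally have "C * real N powr (31 / 32) = (sqrt (real N) / 3) powr (31 / 16) / (4 * real K * D)"
        by (simp add: C_def)
      also have "\<dots> \<le> real X powr (31 / 16) / (4 * real K * D)"
        using X D K by (intro divide_right_mono powr_mono2) auto
      also have "real X powr (31 / 16) = real X * real X / real X powr \<delta>"
      proof -
        have "real X powr (31 / 16) * real X powr \<delta> = real X powr 2"
          by (simp add: \<delta>_def flip: powr_add)
        also have "\<dots> = real X * real X" using X0 by (simp add: powr_numeral power2_eq_square)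
        finally show ?thesis using X0 by (simp add: field_simps)
      qed
      also have "real X * real X / real X powr \<delta> / (4 * real K * D) =
          real X / (2 * real K) * (real X / (2 * D * real X powr \<delta>))"
        using X0 D K by (simp add: field_simps)
      also have "\<dots> \<le> real (X div K) * (real X / (2 * D * real X powr \<delta>))"
        using Y D(1) by (intro mult_right_mono) auto
      also have "\<dots> \<le> real (card (form_box n X))"
        using card_form_box_ge[OF D _ assms, of X] by (simp add: K_def \<delta>_def)
      also have "\<dots> \<le> real (card (root_pairs n N))"
        using card_form_box_le[OF assms XN] by simp
      finally show ?case .
    qed
  qed
qed

section \<open>Lower bound for square \<open>n\<close>\<close>

text \<open>A coprime pair \<open>(y, z)\<close> gives the square root of \<open>k\<^sup>2\<close> modulo \<open>y z\<close> that is \<open>k\<close> modulo \<open>y\<close> and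
  \<open>- k\<close> modulo \<open>z\<close>. Since \<open>gcd (y z, r - k) / y\<close> divides \<open>2 k\<close>, at most \<open>2 k\<close> pairs
  have the same image.\<close>

lemma card_root_pairs_square_ge:
  fixes k :: int
  assumes "k > 0"
  shows "(\<Sum>y=1..Y. (N div y\<^sup>2) * totient y) \<le> card (root_pairs (k\<^sup>2) N) * nat (2 * k)"
proof -
  \<comment> \<open>Cutting off at a multiple of \<open>y\<close> gives whole periods of residues
    and still ensures \<open>y * z \<le> N\<close>.\<close>
  define Z where "Z = (\<lambda>y. {z. 0 < z \<and> z \<le> y * (N div y\<^sup>2) \<and> coprime z y})"
  define Q where "Q = (SIGMA y:{1..Y}. Z y)"
  have finZ: "finite (Z y)" for y
    by (rule finite_subset[of _ "{..y * (N div y\<^sup>2)}"]) (auto simp: Z_def)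
  have ex: "\<exists>r. 0 \<le> r \<and> r < int (y * z) \<and> int y dvd r - k \<and> int z dvd r + k"
    if "y > 0" "z > 0" "coprime z y" for y z :: nat
  proof -
    have "coprime (int y) (int z)" using that by (simp add: coprime_commute)
    then obtain x where x: "[x = k] (mod int y)" "[x = - k] (mod int z)"
      using binary_chinese_remainder_int by blast
    define r where "r = x mod (int y * int z)"
    have "int y * int z dvd r - x" by (simp add: r_def flip: cong_iff_dvd_diff)
    then have "[r = x] (mod int y)" "[r = x] (mod int z)"
      unfolding cong_iff_dvd_diff by (auto intro: dvd_mult_left dvd_mult_right)
    then have "[r = k] (mod int y)" "[r = - k] (mod int z)" using x cong_trans by blast+
    then have "int y dvd r - k" "int z dvd r + k" by (auto simp: cong_iff_dvd_diff)
    moreover have "0 \<le> r" "r < int y * int z" using that by (auto simp: r_def)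
    ultimately show ?thesis by auto
  qed
  define \<rho> where "\<rho> = (\<lambda>y z. SOME r. 0 \<le> r \<and> r < int (y * z) \<and> int y dvd r - k \<and> int z dvd r + k)"
  have \<rho>: "0 \<le> \<rho> y z" "\<rho> y z < int (y * z)" "int y dvd \<rho> y z - k" "int z dvd \<rho> y z + k"
    if "y > 0" "z > 0" "coprime z y" for y z :: nat
    using someI_ex[OF ex[OF that]] unfolding \<rho>_def by blast+
  define g where "g = (\<lambda>(c, r). gcd c (r - k))"
  \<comment> \<open>The second component makes the map injective: the root pair determines the gcd
    \<open>g\<close>, and dividing \<open>g\<close> by this component returns
    \<open>y\<close>.\<close>
  define f where "f = (\<lambda>(y, z). ((int (y * z), \<rho> y z), g (int (y * z), \<rho> y z) div int y))"
  have Q: "0 < y" "0 < z" "y * z \<le> N" "coprime z y" if "(y, z) \<in> Q" for y z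
  proof -
    have "0 < y" "0 < z" "coprime z y" "z \<le> y * (N div y\<^sup>2)" using that by (auto simp: Q_def Z_def)
    moreover have "y * (y * (N div y\<^sup>2)) \<le> N"
      using div_times_less_eq_dividend[of N "y\<^sup>2"] by (simp add: power2_eq_square mult_ac)
    ultimately show "0 < y" "0 < z" "y * z \<le> N" "coprime z y"
      by (auto intro: order_trans[OF mult_le_mono2])
  qed
  have g: "int y dvd g (int (y * z), \<rho> y z)" if "(y, z) \<in> Q" for y z
    using \<rho>[of y z] Q[OF that] by (simp add: g_def)
  have "inj_on f Q"
  proof (rule inj_onI)
    fix p p' assume p: "p \<in> Q" "p' \<in> Q" "f p = f p'"
    obtain y z y' z' where pp: "p = (y, z)" "p' = (y', z')" by fastforce
    define h where "h = g (int (y * z), \<rho> y z)"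
    have eq: "y * z = y' * z'" "h = g (int (y' * z'), \<rho> y' z')" "h div int y = h div int y'"
      using p(3) unfolding f_def pp h_def by (auto simp del: of_nat_mult)
    have pos: "y > 0" "y' > 0" "z > 0" using Q p pp by auto
    have "h > 0" using pos by (simp add: h_def g_def gcd_pos_int)
    have "int y dvd h" using g p(1) unfolding pp h_def by blast
    have "int y' dvd h" using g p(2) unfolding pp eq(2) by blast
    have "h div int y * int y = h div int y * int y'"
      using \<open>int y dvd h\<close> \<open>int y' dvd h\<close> by (metis dvd_div_mult_self eq(3))
    moreover have "h div int y \<noteq> 0"
      using \<open>int y dvd h\<close> \<open>h > 0\<close> by (simp add: dvd_div_eq_0_iff)
    ultimately have "y = y'" by simp
    with eq(1) pos show "p = p'" by (simp add: pp)
  qed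
  moreover have "f ` Q \<subseteq> root_pairs (k\<^sup>2) N \<times> {1..2 * k}"
  proof (rule image_subsetI)
    fix p assume p: "p \<in> Q"
    obtain y z where pp: "p = (y, z)" by fastforce
    note q = Q[OF p[unfolded pp]]
    note r = \<rho>[OF q(1,2,4)]
    define r where "r = \<rho> y z"
    have "(r - k) * (r + k) = r\<^sup>2 - k\<^sup>2" by (simp add: power2_eq_square algebra_simps)
    then have "int y * int z dvd r\<^sup>2 - k\<^sup>2"
      using mult_dvd_mono[OF \<rho>(3,4)[OF q(1,2,4)]] by (simp add: r_def)
    then have 1: "(int (y * z), r) \<in> root_pairs (k\<^sup>2) N"
      using r q by (auto simp: root_pairs_def r_def simp flip: of_nat_mult)
    obtain v where v: "r - k = int y * v" using r(3) unfolding r_def by blast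
    have "g (int (y * z), r) = int y * gcd (int z) v"
      by (simp add: g_def v gcd_mult_left)
    then have d: "g (int (y * z), r) div int y = gcd (int z) v" using q by simp
    have "gcd (int z) v dvd r + k" using r(4) unfolding r_def by (meson dvd_trans gcd_dvd1)
    moreover have "gcd (int z) v dvd r - k" unfolding v by simp
    ultimately have "gcd (int z) v dvd (r + k) - (r - k)" by (rule dvd_diff)
    then have "gcd (int z) v dvd 2 * k" by simp
    then have "gcd (int z) v \<le> 2 * k" using assms by (intro zdvd_imp_le) auto
    moreover have "1 \<le> gcd (int z) v" using q gcd_pos_int[of "int z" v] by linarith
    ultimately show "f p \<in> root_pairs (k\<^sup>2) N \<times> {1..2 * k}"
      using 1 d by (simp add: f_def pp r_def)
  qed
  ultimately have "card Q \<le> card (root_pairs (k\<^sup>2) N \<times> {1..2 * k})"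
    by (intro card_inj_on_le) auto
  also have "\<dots> = card (root_pairs (k\<^sup>2) N) * nat (2 * k)" by (simp add: card_cartesian_product)
  finally have upper: "card Q \<le> card (root_pairs (k\<^sup>2) N) * nat (2 * k)" .
  have "(\<Sum>y=1..Y. (N div y\<^sup>2) * totient y) \<le> (\<Sum>y=1..Y. card (Z y))"
  proof (rule sum_mono)
    fix y assume "y \<in> {1..Y}"
    then show "(N div y\<^sup>2) * totient y \<le> card (Z y)"
      using card_coprime_interval_ge[of y "N div y\<^sup>2" 0] by (simp add: Z_def)
  qed
  also have "\<dots> = card Q" unfolding Q_def using finZ by (simp add: card_SigmaI)
  finally show ?thesis using upper by linarith
qed

text \<open>For fixed \<open>Y\<close>, rounding in \<open>N div y^2\<close> costs at most
  \<open>totient y \<le> Y\<close> per term, so \<open>N * S Y - Y^2\<close> bounds the count times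
  \<open>2 k\<close> from below. Since \<open>S\<close> diverges, the factor of \<open>N\<close> can
  be made arbitrarily large.\<close>

lemma card_root_pairs_square_at_top:
  fixes k :: int
  assumes "k > 0"
  shows "filterlim (\<lambda>N. real (card (root_pairs (k\<^sup>2) N)) / real N) at_top sequentially"
  unfolding filterlim_at_top
proof
  fix M :: real
  define S where "S = (\<lambda>Y. \<Sum>y=1..Y. real (totient y) / real y ^ 2)"
  have "eventually (\<lambda>Y. S Y \<ge> (M + 1) * (2 * k)) sequentially"
    using sum_totient_div_square_at_top unfolding S_def filterlim_at_top by blast
  \<comment> \<open>The surplus \<open>2 * k\<close> over \<open>M * (2 * k)\<close> pays for the
    rounding error \<open>Y^2 \<le> N\<close>.\<close>
  then obtain Y where Y: "S Y \<ge> (M + 1) * (2 * k)" by (auto simp: eventually_sequentially)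
  have "M \<le> real (card (root_pairs (k\<^sup>2) N)) / real N" if "N \<ge> Y\<^sup>2 + 1" for N
  proof -
    have N: "real N > 0" "real Y * real Y \<le> real N"
    proof -
      show "real N > 0" using that by simp
      have "real (Y\<^sup>2) \<le> real N" using that by (simp only: of_nat_le_iff)
      then show "real Y * real Y \<le> real N" by (simp add: power2_eq_square)
    qed
    have "real N * S Y - real Y * real Y = (\<Sum>y=1..Y. real N * (real (totient y) / real y ^ 2) - real Y)"
      by (simp add: S_def sum_distrib_left sum_subtractf)
    also have "\<dots> \<le> (\<Sum>y=1..Y. real (N div y\<^sup>2) * real (totient y))"
    proof (rule sum_mono)
      fix y assume y: "y \<in> {1..Y}"
      have "real N / (real y)\<^sup>2 - 1 \<le> real (N div y\<^sup>2)"
        using real_div_le_nat_div[of "y\<^sup>2" N] y by simp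
      then have "(real N / real y ^ 2 - 1) * real (totient y) \<le> real (N div y\<^sup>2) * real (totient y)"
        by (intro mult_right_mono) auto
      moreover have "real (totient y) \<le> real Y" using y totient_le[of y] by simp
      ultimately show "real N * (real (totient y) / real y ^ 2) - real Y \<le> real (N div y\<^sup>2) * real (totient y)"
        by (simp add: algebra_simps)
    qed
    also have "\<dots> = real (\<Sum>y=1..Y. (N div y\<^sup>2) * totient y)" by simp
    also have "\<dots> \<le> real (card (root_pairs (k\<^sup>2) N) * nat (2 * k))"
      using card_root_pairs_square_ge[OF assms] by (simp only: of_nat_le_iff)
    also have "\<dots> = real (card (root_pairs (k\<^sup>2) N)) * (2 * k)" using assms by simp
    finally have "real N * S Y - real Y * real Y \<le> real (card (root_pairs (k\<^sup>2) N)) * (2 * k)" .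
    moreover have "real N * ((M + 1) * (2 * k)) \<le> real N * S Y" using Y N by (intro mult_left_mono) auto
    ultimately have "real N * ((M + 1) * (2 * k)) - real N \<le> real (card (root_pairs (k\<^sup>2) N)) * (2 * k)"
      using N by linarith
    moreover have "real N * 1 \<le> real N * (2 * k)" using assms N by (intro mult_left_mono) auto
    ultimately have "(real N * M) * (2 * k) \<le> real (card (root_pairs (k\<^sup>2) N)) * (2 * k)"
      by (simp add: algebra_simps)
    then have "real N * M \<le> real (card (root_pairs (k\<^sup>2) N))" using assms by simp
    then show ?thesis using N by (simp add: field_simps)
  qed
  then show "eventually (\<lambda>N. M \<le> real (card (root_pairs (k\<^sup>2) N)) / real N) sequentially"
    unfolding eventually_sequentially by blast
qed

section \<open>Asymptotics\<close>

lemma asymp_equiv_of_sandwich: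
  fixes a b g u v :: "nat \<Rightarrow> real"
  assumes g: "eventually (\<lambda>N. g N > 0) sequentially"
    and u: "(\<lambda>N. u N / g N) \<longlonglongrightarrow> 0" and v: "(\<lambda>N. v N / g N) \<longlonglongrightarrow> 0"
    and a: "\<And>N. g N / 2 \<le> a N" "\<And>N. a N \<le> g N / 2 + u N"
    and b: "\<And>N. g N \<le> b N" "\<And>N. b N \<le> g N + v N"
  shows "a \<sim>[at_top] (\<lambda>N. b N / 2)"
proof -
  have "(\<lambda>N. a N / (g N / 2)) \<longlonglongrightarrow> 1"
  proof (rule tendsto_sandwich)
    show "eventually (\<lambda>N. 1 \<le> a N / (g N / 2)) sequentially"
      using g by eventually_elim (use a in \<open>simp add: field_simps\<close>)
    show "eventually (\<lambda>N. a N / (g N / 2) \<le> 1 + 2 * (u N / g N)) sequentially"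
      using g
    proof eventually_elim
      case (elim N)
      then show ?case using a(2)[of N] by (simp add: field_simps)
    qed
    have "(\<lambda>N. 1 + 2 * (u N / g N)) \<longlonglongrightarrow> 1 + 2 * 0" by (intro tendsto_intros u)
    then show "(\<lambda>N. 1 + 2 * (u N / g N)) \<longlonglongrightarrow> 1" by simp
  qed simp
  then have 1: "a \<sim>[at_top] (\<lambda>N. g N / 2)" by (rule asymp_equivI')
  have "(\<lambda>N. b N / g N) \<longlonglongrightarrow> 1"
  proof (rule tendsto_sandwich)
    show "eventually (\<lambda>N. 1 \<le> b N / g N) sequentially"
      using g by eventually_elim (use b in \<open>simp add: field_simps\<close>)
    show "eventually (\<lambda>N. b N / g N \<le> 1 + v N / g N) sequentially"
      using g
    proof eventually_elim
      case (elim N)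
      then show ?case using b(2)[of N] by (simp add: field_simps)
    qed
    have "(\<lambda>N. 1 + v N / g N) \<longlonglongrightarrow> 1 + 0" by (intro tendsto_intros v)
    then show "(\<lambda>N. 1 + v N / g N) \<longlonglongrightarrow> 1" by simp
  qed simp
  then have "b \<sim>[at_top] g" by (rule asymp_equivI')
  then have "(\<lambda>N. b N / 2) \<sim>[at_top] (\<lambda>N. g N / 2)" by (intro asymp_equiv_intros)
  with 1 show ?thesis by (blast intro: asymp_equiv_trans asymp_equiv_symI)
qed

lemma inner_pairs_dominant_nonsquare:
  assumes "n \<noteq> 0" "\<not> is_square n"
  obtains c where "c > 0" "eventually (\<lambda>N. c * real N powr (31 / 32) \<le> real (card (inner_pairs n N))) sequentially"
    "(\<lambda>N. real (card (root_pairs n N - inner_pairs n N)) / real (card (inner_pairs n N))) \<longlonglongrightarrow> 0"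
proof -
  obtain C where C: "C > 0"
    "eventually (\<lambda>N. C * real N powr (31 / 32) \<le> real (card (root_pairs n N))) sequentially"
    using card_root_pairs_ge[OF assms(1)] .
  obtain K where K: "\<And>N. card (root_pairs n N - inner_pairs n N) \<le> K"
    using card_outer_pairs_bounded[OF assms(2)] by blast
  have lim: "filterlim (\<lambda>N. C / 2 * real N powr (31 / 32)) at_top sequentially"
    using C(1) by real_asymp
  then have "eventually (\<lambda>N. real K \<le> C / 2 * real N powr (31 / 32)) sequentially"
    unfolding filterlim_at_top by blast
  with C(2) have low: "eventually (\<lambda>N. C / 2 * real N powr (31 / 32) \<le> real (card (inner_pairs n N))) sequentially"
  proof eventually_elim
    case (elim N)
    have "real (card (root_pairs n N)) \<le> real (card (inner_pairs n N)) + real K"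
      using K[of N] card_root_pairs_eq[of n N] by linarith
    with elim show ?case by simp
  qed
  have "(\<lambda>N. real (card (root_pairs n N - inner_pairs n N)) / real (card (inner_pairs n N))) \<longlonglongrightarrow> 0"
  proof (rule tendsto_sandwich[of "\<lambda>_. 0"])
    have "filterlim (\<lambda>N. real (card (inner_pairs n N))) at_top sequentially"
      using lim low by (rule filterlim_at_top_mono)
    then show "(\<lambda>N. real K / real (card (inner_pairs n N))) \<longlonglongrightarrow> 0"
      by (intro tendsto_divide_0[OF tendsto_const] filterlim_at_top_imp_at_infinity)
    show "eventually (\<lambda>N. real (card (root_pairs n N - inner_pairs n N)) / real (card (inner_pairs n N))
        \<le> real K / real (card (inner_pairs n N))) sequentially"
      using K by (intro always_eventually allI divide_right_mono) auto
  qed auto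
  with that[of "C / 2"] C(1) low show thesis by simp
qed

text \<open>Superlinear growth of the inner pairs settles both claims, since the outer pairs are
  \<open>O(N)\<close>. The lower bound is weakened to the exponent of the non-square case so that
  the final argument is uniform.\<close>

lemma inner_pairs_dominant_square:
  assumes "n \<noteq> 0" "is_square n"
  obtains c where "c > 0" "eventually (\<lambda>N. c * real N powr (31 / 32) \<le> real (card (inner_pairs n N))) sequentially"
    "(\<lambda>N. real (card (root_pairs n N - inner_pairs n N)) / real (card (inner_pairs n N))) \<longlonglongrightarrow> 0"
proof -
  obtain k where k: "0 \<le> k" "n = k\<^sup>2" using assms(2) by (rule is_squareE_nonneg)
  then have "k > 0" using assms(1) by (cases "k = 0") auto
  define K where "K = real (2 * nat (\<bar>n\<bar> + 2))"
  have outer: "real (card (root_pairs n N - inner_pairs n N)) \<le> K * real N" for N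
  proof -
    have "real (card (root_pairs n N - inner_pairs n N)) \<le> real (2 * nat (\<bar>n\<bar> + 2) * N)"
      using card_outer_pairs_le by (simp only: of_nat_le_iff)
    then show ?thesis by (simp only: of_nat_mult K_def)
  qed
  have "filterlim (\<lambda>N. - K + real (card (root_pairs n N)) / real N) at_top sequentially"
    using filterlim_tendsto_add_at_top[OF tendsto_const card_root_pairs_square_at_top[OF \<open>k > 0\<close>]]
    by (simp only: k(2))
  moreover have "eventually (\<lambda>N. - K + real (card (root_pairs n N)) / real N \<le> real (card (inner_pairs n N)) / real N) sequentially"
    using eventually_gt_at_top[of 0]
  proof eventually_elim
    case (elim N)
    have "real (card (root_pairs n N)) \<le> real (card (inner_pairs n N)) + K * real N"
      using outer[of N] card_root_pairs_eq[of n N] by linarith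
    then have "real (card (root_pairs n N)) / real N \<le> (real (card (inner_pairs n N)) + K * real N) / real N"
      by (rule divide_right_mono) simp
    also have "\<dots> = real (card (inner_pairs n N)) / real N + K"
      using elim by (simp add: add_divide_distrib)
    finally show ?case by simp
  qed
  ultimately have lim: "filterlim (\<lambda>N. real (card (inner_pairs n N)) / real N) at_top sequentially"
    by (rule filterlim_at_top_mono)
  then have "eventually (\<lambda>N. 1 \<le> real (card (inner_pairs n N)) / real N) sequentially"
    unfolding filterlim_at_top by blast
  then have low: "eventually (\<lambda>N. 1 * real N powr (31 / 32) \<le> real (card (inner_pairs n N))) sequentially"
    using eventually_gt_at_top[of 0]
  proof eventually_elim
    case (elim N)
    have "real N powr (31 / 32) \<le> real N powr 1" using elim(2) by (intro powr_mono) auto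
    with elim show ?case by (simp add: field_simps)
  qed
  have "(\<lambda>N. real (card (root_pairs n N - inner_pairs n N)) / real (card (inner_pairs n N))) \<longlonglongrightarrow> 0"
  proof (rule tendsto_sandwich[of "\<lambda>_. 0"])
    show "(\<lambda>N. K / (real (card (inner_pairs n N)) / real N)) \<longlonglongrightarrow> 0"
      using lim by (intro tendsto_divide_0[OF tendsto_const] filterlim_at_top_imp_at_infinity)
    show "eventually (\<lambda>N. real (card (root_pairs n N - inner_pairs n N)) / real (card (inner_pairs n N))
        \<le> K / (real (card (inner_pairs n N)) / real N)) sequentially"
    proof (intro always_eventually allI)
      fix N
      have "real (card (root_pairs n N - inner_pairs n N)) / real (card (inner_pairs n N))
          \<le> (K * real N) / real (card (inner_pairs n N))"
        using outer by (intro divide_right_mono) auto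
      then show "real (card (root_pairs n N - inner_pairs n N)) / real (card (inner_pairs n N))
          \<le> K / (real (card (inner_pairs n N)) / real N)" by simp
    qed
  qed auto
  with that[of 1] low show thesis by simp
qed

lemma inner_pairs_dominant:
  assumes "n \<noteq> 0"
  obtains c where "c > 0" "eventually (\<lambda>N. c * real N powr (31 / 32) \<le> real (card (inner_pairs n N))) sequentially"
    "(\<lambda>N. real (card (root_pairs n N - inner_pairs n N)) / real (card (inner_pairs n N))) \<longlonglongrightarrow> 0"
proof (cases "is_square n")
  case True
  then show thesis using that by (rule inner_pairs_dominant_square[OF assms])
next
  case False
  then show thesis using that by (rule inner_pairs_dominant_nonsquare[OF assms])
qed

theorem theorem3:
  fixes n :: int
  assumes "n \<noteq> 0"
  shows "(\<lambda>N. real (D_count 3 n N)) \<sim>[at_top] (\<lambda>N. real (D_count 2 n N) / 2)"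
proof -
  obtain c where c: "c > 0"
    "eventually (\<lambda>N. c * real N powr (31 / 32) \<le> real (card (inner_pairs n N))) sequentially"
    "(\<lambda>N. real (card (root_pairs n N - inner_pairs n N)) / real (card (inner_pairs n N))) \<longlonglongrightarrow> 0"
    using inner_pairs_dominant[OF assms] .
  obtain C where C: "C > 0" "\<And>N. N \<ge> 1 \<Longrightarrow> real (card (irregular_params n N)) \<le> C * real N powr (7 / 8)"
    using card_irregular_params_le[OF assms] by blast
  define K3 K2 :: nat where "K3 = 2 ^ nat ((\<bar>n\<bar> + 2)\<^sup>2 + 4 * \<bar>n\<bar>)" and "K2 = 2 ^ nat \<bar>n\<bar>"
  define g where "g = (\<lambda>N. real (card (inner_pairs n N)))"
  define u where "u = (\<lambda>N. real (card (irregular_params n N)) + real K3)"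
  define v where "v = (\<lambda>N. real (card (root_pairs n N - inner_pairs n N)) + real K2)"
  have pos: "eventually (\<lambda>N. g N > 0) sequentially"
    using c(2) eventually_gt_at_top[of 0]
  proof eventually_elim
    case (elim N)
    have "0 < c * real N powr (31 / 32)" using c(1) elim(2) by simp
    with elim(1) show ?case by (simp add: g_def)
  qed
  \<comment> \<open>The decisive inequality is \<open>7/8 < 31/32\<close>; the constant
    \<open>K\<close> accommodates the finitely many exceptional sets.\<close>
  have small: "(\<lambda>N. w N / g N) \<longlonglongrightarrow> 0"
    if "eventually (\<lambda>N. 0 \<le> w N \<and> w N \<le> C * real N powr (7 / 8) + K) sequentially" "K \<ge> 0" for w K
  proof (rule tendsto_sandwich[of "\<lambda>_. 0"])
    show "(\<lambda>N. (C * real N powr (7 / 8) + K) / (c * real N powr (31 / 32))) \<longlonglongrightarrow> 0"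
      using c(1) C(1) by real_asymp
    show "eventually (\<lambda>N. w N / g N \<le> (C * real N powr (7 / 8) + K) / (c * real N powr (31 / 32))) sequentially"
      using c(2) eventually_gt_at_top[of 0] that(1)
    proof eventually_elim
      case (elim N)
      have "0 < c * real N powr (31 / 32)" using c(1) elim(2) by simp
      with elim show ?case unfolding g_def by (intro frac_le) auto
    qed
    show "eventually (\<lambda>N. 0 \<le> w N / g N) sequentially"
      using that(1) by eventually_elim (simp add: g_def)
  qed simp
  have "(\<lambda>N. u N / g N) \<longlonglongrightarrow> 0"
  proof (rule small)
    show "eventually (\<lambda>N. 0 \<le> u N \<and> u N \<le> C * real N powr (7 / 8) + real K3) sequentially"
      using eventually_ge_at_top[of 1] by eventually_elim (use C(2) in \<open>simp add: u_def\<close>)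
  qed simp
  moreover have "(\<lambda>N. v N / g N) \<longlonglongrightarrow> 0"
  proof -
    have "(\<lambda>N. real K2 / g N) \<longlonglongrightarrow> 0"
      using C(1) by (intro small[of _ "real K2"]) auto
    from tendsto_add[OF c(3) this] show ?thesis by (simp add: v_def g_def add_divide_distrib)
  qed
  ultimately show ?thesis
  proof (rule asymp_equiv_of_sandwich[OF pos])
    fix N
    show "g N / 2 \<le> real (D_count 3 n N)"
      using card_half_pairs_le_D_count[of n N] card_inner_pairs[OF assms, of N] by (simp add: g_def)
    show "real (D_count 3 n N) \<le> g N / 2 + u N"
    proof -
      have "real (D_count 3 n N) \<le> real (card (half_pairs n N) + card (irregular_params n N) + K3)"
        using D_count_3_le[OF assms, of N] unfolding K3_def by (simp only: of_nat_le_iff)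
      then show ?thesis using card_inner_pairs[OF assms, of N] by (simp add: g_def u_def)
    qed
    show "g N \<le> real (D_count 2 n N)"
      using card_inner_pairs_le_D_count by (simp add: g_def)
    show "real (D_count 2 n N) \<le> g N + v N"
    proof -
      have "real (D_count 2 n N) \<le> real (card (root_pairs n N) + K2)"
        using D_count_2_le[of n N] unfolding K2_def by (simp only: of_nat_le_iff)
      then show ?thesis using card_root_pairs_eq[of n N] by (simp add: g_def v_def)
    qed
  qed
qed

end
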